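(* Let $s\ge 2$ and $N^0_{s-1}=\{0,1,\dots,s-1\}$. Let $q_0,\dots,q_{s-1}>0$ with $\sum_{i=0}^{s-1}q_i=1$ and $p_0,\dots,p_{s-1}\ge 0$ with $\sum_{i=0}^{s-1}p_i=1$, and put $q_{ik}=q_i$, $p_{ik}=p_i$ for all $k\in\mathbb N$, $i\in N^0_{s-1}$. Let $\xi=\Delta^{\widetilde Q}_{\xi_1\xi_2\dots\xi_k\dots}$, where $(\xi_k)_{k\in\mathbb N}$ are independent random variables with $P(\xi_k=i)=p_i$, $i\in N^0_{s-1}$, and let $P_\xi$ be the distribution of $\xi$. Let $$M[\widetilde Q,(p_0,\dots,p_{s-1})]=\Big\{x\in[0,1]:\ \lim_{k\to\infty}\frac{N_i(x,k)}{k}=p_i,\ i\in N^0_{s-1}\Big\},$$ where $N_i(x,k)$ is the number of symbols "$i$" among the first $k$ symbols of the $\widetilde Q$-representation of $x$. Then one may take $E_\xi=M[\widetilde Q,(p_0,\dots,p_{s-1})]$, i.e. $P_\xi\big(M[\widetilde Q,(p_0,\dots,p_{s-1})]\big)=1$ and $\alpha_0\big(M[\widetilde Q,(p_0,\dots,p_{s-1})]\big)=\alpha_0(\xi)$, and $$\alpha_0(\xi)=\frac{\sum_{i=0}^{s-1}p_i\ln p_i}{\sum_{i=0}^{s-1}p_i\ln q_i}.$$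
   Context: Intervals and representation: $\Delta^{\widetilde Q}_{i_1}=[\sum_{j<i_1}q_{j1},\sum_{j\le i_1}q_{j1}]$ for $i_1\in\{0,\dots,s-1\}$, and inductively each $\Delta^{\widetilde Q}_{i_1\dots i_{k-1}}$ is decomposed from left to right, in increasing order of $i_k\in\{0,\dots,s-1\}$, into closed intervals $\Delta^{\widetilde Q}_{i_1\dots i_k}$ without common interior points, of length $\prod_{l=1}^k q_{i_l l}$. For a sequence $(i_k)$ of symbols, $\Delta^{\widetilde Q}_{i_1i_2\dots i_k\dots}$ denotes the unique point of $\bigcap_k\Delta^{\widetilde Q}_{i_1\dots i_k}$; if $x$ is this point, $(i_k)$ is called the $\widetilde Q$-representation of $x$ (unique for all $x\in[0,1]$ except countably many points, which have two representations). $\alpha_0(E)$ denotes the Hausdorff (Hausdorff–Besicovitch) dimension of a set $E$. The Hausdorff–Besicovitch dimension of the distribution of $\xi$ is $\alpha_0(\xi)=\inf\{\alpha_0(E): E \text{ Borel},\ P_\xi(E)=1\}$, and $E_\xi$ denotes a support of $\xi$ (a set with $P_\xi(E_\xi)=1$) such that $\alpha_0(E_\xi)=\alpha_0(\xi)$. Convention: $0\ln 0=0$. *)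

theory Defs
  imports "HOL-Probability.Probability"
begin

text \<open>
  Hausdorff measure and dimension. The case distinction in the gauge is needed because
  \<open>0 powr 0 = 0\<close> in HOL: a nonempty set must contribute 1 when the exponent is 0, the empty
  set always contributes 0. The latter also makes finite covers a special case of sequences.
\<close>

definition hausdorff_gauge :: "real \<Rightarrow> 'a::metric_space set \<Rightarrow> ennreal" where
  "hausdorff_gauge \<alpha> U =
     (if U = {} then 0 else if \<alpha> = 0 then 1 else ennreal (diameter U powr \<alpha>))"

definition delta_covers :: "real \<Rightarrow> 'a::metric_space set \<Rightarrow> (nat \<Rightarrow> 'a set) set" where
  "delta_covers \<delta> E = {U. E \<subseteq> (\<Union>n. U n) \<and> (\<forall>n. bounded (U n) \<and> diameter (U n) \<le> \<delta>)}"

definition hausdorff_premeasure :: "real \<Rightarrow> real \<Rightarrow> 'a::metric_space set \<Rightarrow> ennreal" where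
  "hausdorff_premeasure \<alpha> \<delta> E = (INF U\<in>delta_covers \<delta> E. \<Sum>n. hausdorff_gauge \<alpha> (U n))"

definition hausdorff_measure :: "real \<Rightarrow> 'a::metric_space set \<Rightarrow> ennreal" where
  "hausdorff_measure \<alpha> E = (SUP \<delta>\<in>{0<..}. hausdorff_premeasure \<alpha> \<delta> E)"

definition hausdorff_dim :: "'a::metric_space set \<Rightarrow> ereal" where
  "hausdorff_dim E = (INF \<alpha>\<in>{\<alpha>. 0 \<le> \<alpha> \<and> hausdorff_measure \<alpha> E = 0}. ereal \<alpha>)"

definition distribution_dim :: "real measure \<Rightarrow> ereal" where
  "distribution_dim \<mu> = (INF E\<in>{E. E \<in> sets borel \<and> emeasure \<mu> E = 1}. hausdorff_dim E)"

text \<open>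
  Symbols and matrix columns are numbered from 1: the sequence \<open>d\<close> stands for
  \<open>d 1, d 2, \<dots>\<close> (the value \<open>d 0\<close> is never used), and \<open>q i k\<close> is the ratio belonging to
  symbol \<open>i\<close> in position \<open>k\<close>. The cylinder of rank \<open>k\<close> depends on \<open>d 1, \<dots>, d k\<close> only;
  to its left, inside the cylinder of rank \<open>k - 1\<close>, lie those with last symbol \<open>j < d k\<close>.
\<close>

definition cylinder_length :: "(nat \<Rightarrow> nat \<Rightarrow> real) \<Rightarrow> (nat \<Rightarrow> nat) \<Rightarrow> nat \<Rightarrow> real" where
  "cylinder_length q d k = (\<Prod>l=1..k. q (d l) l)"

primrec cylinder_left :: "(nat \<Rightarrow> nat \<Rightarrow> real) \<Rightarrow> (nat \<Rightarrow> nat) \<Rightarrow> nat \<Rightarrow> real" where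
  "cylinder_left q d 0 = 0"
| "cylinder_left q d (Suc k) =
     cylinder_left q d k + (\<Sum>j<d (Suc k). cylinder_length q d k * q j (Suc k))"

definition cylinder :: "(nat \<Rightarrow> nat \<Rightarrow> real) \<Rightarrow> (nat \<Rightarrow> nat) \<Rightarrow> nat \<Rightarrow> real set" where
  "cylinder q d k = {cylinder_left q d k .. cylinder_left q d k + cylinder_length q d k}"

definition Q_point :: "(nat \<Rightarrow> nat \<Rightarrow> real) \<Rightarrow> (nat \<Rightarrow> nat) \<Rightarrow> real" where
  "Q_point q d = (THE x. x \<in> (\<Inter>k\<in>{1..}. cylinder q d k))"

definition is_Q_representation ::
  "nat \<Rightarrow> (nat \<Rightarrow> nat \<Rightarrow> real) \<Rightarrow> real \<Rightarrow> (nat \<Rightarrow> nat) \<Rightarrow> bool" where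
  "is_Q_representation s q x d \<longleftrightarrow> (\<forall>k\<ge>1. d k < s) \<and> Q_point q d = x"

text \<open>
  Below, \<open>rep x\<close> is the representation of \<open>x\<close>; the argument makes explicit the choice that
  has to be made at the countably many points having two representations.
\<close>

definition symbol_count :: "(real \<Rightarrow> nat \<Rightarrow> nat) \<Rightarrow> nat \<Rightarrow> real \<Rightarrow> nat \<Rightarrow> nat" where
  "symbol_count rep i x k = card {l\<in>{1..k}. rep x l = i}"

definition frequency_set :: "nat \<Rightarrow> (real \<Rightarrow> nat \<Rightarrow> nat) \<Rightarrow> (nat \<Rightarrow> real) \<Rightarrow> real set" where
  "frequency_set s rep p =
     {x\<in>{0..1}. \<forall>i<s. (\<lambda>k. real (symbol_count rep i x k) / real k) \<longlonglongrightarrow> p i}"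

end

theory Submission
  imports Defs "HOL-Library.Sublist"
begin

text \<open>
  Put \<open>H = (\<Sum>i<s. p i * ln (p i))\<close> and \<open>L = (\<Sum>i<s. p i * ln (q i)) < 0\<close>. If the digits of \<open>x\<close> have
  frequencies \<open>p\<close>, its cylinder of rank \<open>k\<close> has length \<open>exp (k * L + o(k))\<close>. By the law of large
  numbers almost every value of \<open>\<xi>\<close> is such a point, and there the cylinder has probability
  \<open>exp (k * H + o(k))\<close>: on a set of full measure the mass of small cylinders is the power \<open>H / L\<close> of
  their length, up to an arbitrarily small change of the exponent. Both dimension bounds follow from
  this comparison.

  Upper bound (\<open>hausdorff_measure_frequency_points_eq_0\<close>). For \<open>\<alpha> > H / L\<close> the points with
  frequencies \<open>p\<close> are covered, at every large rank \<open>k\<close>, by cylinders whose length to the power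
  \<open>\<alpha>\<close> is at most \<open>exp (- c * k)\<close> times their mass; the masses of one rank add up to 1. Digits with
  \<open>p i = 0\<close> may still occur in such points (with frequency 0) and would make the mass vanish, so the
  mass is measured with a slightly perturbed, strictly positive probability vector.

  Lower bound (\<open>hausdorff_measure_full_set_ne_0\<close>). For \<open>\<alpha> < H / L\<close> some event of positive
  probability forces all cylinders from some rank on to have mass at most their length to the power
  \<open>\<alpha>\<close>. A ball of radius \<open>r\<close> is covered by disjoint cylinders of length about \<open>r\<close>, of bounded
  total length relative to \<open>r\<close>. So the part of the ball reached on this event has mass
  \<open>O(r powr \<alpha>)\<close>, and the mass distribution principle applies to every set of full measure.

  It remains to see that \<open>\<xi>\<close> falls into the frequency set almost surely, although \<open>rep\<close> may
  prescribe the wrong representation at the countably many interval endpoints. If \<open>H < 0\<close>, the ball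
  estimate with \<open>r = 0\<close> excludes atoms, so the endpoints have probability 0. If \<open>H = 0\<close>, one digit
  has probability 1, and \<open>\<xi>\<close> is almost surely the point all of whose digits equal it; that
  point has only one representation.
\<close>

section \<open>Words and digit frequencies\<close>

text \<open>
  Since the ratios do not depend on the position, a cylinder is determined by a finite word, and
  recursion from the first letter expresses self-similarity: the cylinder of \<open>i # w\<close> is the image
  of the cylinder of \<open>w\<close> under the affine map of slope \<open>q i\<close> onto the first-level interval of \<open>i\<close>.
  The product \<open>word_weight\<close> serves both for lengths (ratios \<open>q\<close>) and for probabilities
  (weights \<open>p\<close>).
\<close>

definition word_weight :: "('a \<Rightarrow> real) \<Rightarrow> 'a list \<Rightarrow> real" where
  "word_weight r w = prod_list (map r w)"

primrec word_left :: "(nat \<Rightarrow> real) \<Rightarrow> nat list \<Rightarrow> real" where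
  "word_left q [] = 0"
| "word_left q (i # w) = (\<Sum>j<i. q j) + q i * word_left q w"

definition word_cylinder :: "(nat \<Rightarrow> real) \<Rightarrow> nat list \<Rightarrow> real set" where
  "word_cylinder q w = {word_left q w .. word_left q w + word_weight q w}"

definition digits :: "(nat \<Rightarrow> 'a) \<Rightarrow> nat \<Rightarrow> 'a list" where
  "digits d k = map d [1..<Suc k]"

definition words :: "nat \<Rightarrow> nat \<Rightarrow> nat list set" where
  "words s k = {w. set w \<subseteq> {..<s} \<and> length w = k}"

lemma word_weight_simps [simp]:
  "word_weight r [] = 1"
  "word_weight r (i # w) = r i * word_weight r w"
  "word_weight r (v @ w) = word_weight r v * word_weight r w"
  by (simp_all add: word_weight_def)

lemma word_left_append:
  "word_left q (v @ w) = word_left q v + word_weight q v * word_left q w"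
  by (induction v) (simp_all add: algebra_simps)

lemma length_digits [simp]: "length (digits d k) = k"
  by (simp add: digits_def)

lemma digits_0 [simp]: "digits d 0 = []"
  by (simp add: digits_def)

lemma digits_Suc: "digits d (Suc k) = digits d k @ [d (Suc k)]"
  by (simp add: digits_def)

lemma set_digits: "set (digits d k) = d ` {1..k}"
  by (auto simp: digits_def)

lemma digits_eq_iff: "digits d k = digits e k \<longleftrightarrow> (\<forall>l\<in>{1..k}. d l = e l)"
  by (auto simp: digits_def)

lemma digits_in_words: "(\<And>l. l \<ge> 1 \<Longrightarrow> d l < s) \<Longrightarrow> digits d k \<in> words s k"
  by (auto simp: words_def set_digits)

lemma digits_append: "\<exists>w. digits d (k + m) = digits d k @ w"
  by (induction m) (auto simp: digits_Suc)

lemma word_weight_digits: "word_weight r (digits d k) = (\<Prod>l=1..k. r (d l))"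
  by (induction k) (simp_all add: digits_Suc)

lemma cylinder_eq_word_cylinder: "cylinder (\<lambda>i k. q i) d k = word_cylinder q (digits d k)"
proof -
  have len: "cylinder_length (\<lambda>i k. q i) d k = word_weight q (digits d k)" for k
    by (simp add: cylinder_length_def word_weight_digits)
  have "cylinder_left (\<lambda>i k. q i) d k = word_left q (digits d k)"
    by (induction k) (simp_all add: digits_Suc word_left_append len sum_distrib_left)
  thus ?thesis by (simp add: cylinder_def word_cylinder_def len)
qed

lemma finite_words [simp]: "finite (words s k)"
  unfolding words_def by (rule finite_lists_length_eq) simp

text \<open>
  Expanding the power of the sum. For a probability vector the weights of the words of each length
  thus add up to 1.
\<close>

lemma sum_word_weight: "(\<Sum>w\<in>words s k. word_weight r w) = (\<Sum>i<s. r i) ^ k"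
proof (induction k)
  case 0
  have "words s 0 = {[]}" by (auto simp: words_def)
  thus ?case by simp
next
  case (Suc k)
  have eq: "words s (Suc k) = (\<lambda>(w, i). i # w) ` (words s k \<times> {..<s})"
    unfolding words_def by (rule lists_length_Suc_eq)
  have "inj_on (\<lambda>(w, i). i # w) (words s k \<times> {..<s})"
    by (auto simp: inj_on_def)
  hence "(\<Sum>w\<in>words s (Suc k). word_weight r w) = (\<Sum>(w, i)\<in>words s k \<times> {..<s}. r i * word_weight r w)"
    unfolding eq by (subst sum.reindex) (auto simp: case_prod_unfold)
  also have "\<dots> = (\<Sum>w\<in>words s k. word_weight r w) * (\<Sum>i<s. r i)"
    unfolding sum.cartesian_product [symmetric] sum_product by (simp add: mult.commute)
  finally show ?case by (simp add: Suc)
qed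

definition has_frequencies :: "nat \<Rightarrow> (nat \<Rightarrow> nat) \<Rightarrow> (nat \<Rightarrow> real) \<Rightarrow> bool" where
  "has_frequencies s d p \<longleftrightarrow>
     (\<forall>i<s. (\<lambda>k. real (card {l\<in>{1..k}. d l = i}) / real k) \<longlonglongrightarrow> p i)"

lemma has_frequencies_cong:
  assumes "\<And>l. l \<ge> 1 \<Longrightarrow> d l = e l"
  shows "has_frequencies s d p \<longleftrightarrow> has_frequencies s e p"
proof -
  have "{l\<in>{1..k}. d l = i} = {l\<in>{1..k}. e l = i}" for k i using assms by auto
  thus ?thesis by (simp add: has_frequencies_def)
qed

lemma mem_frequency_set_iff:
  "x \<in> frequency_set s rep p \<longleftrightarrow> x \<in> {0..1} \<and> has_frequencies s (rep x) p"
  by (auto simp: frequency_set_def has_frequencies_def symbol_count_def)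

text \<open>
  Grouping the first \<open>k\<close> digits by value turns the average of \<open>f\<close> into a finite combination of the
  digit frequencies.
\<close>

lemma has_frequencies_imp_average:
  assumes "\<And>l. l \<ge> 1 \<Longrightarrow> d l < s" and "has_frequencies s d p"
  shows "(\<lambda>k. (\<Sum>l=1..k. f (d l)) / real k) \<longlonglongrightarrow> (\<Sum>i<s. p i * (f i :: real))"
proof -
  have "(\<Sum>l=1..k. f (d l)) = (\<Sum>i<s. real (card {l\<in>{1..k}. d l = i}) * f i)" for k
  proof -
    have "(\<Sum>l=1..k. f (d l)) = (\<Sum>i<s. \<Sum>l | l \<in> {1..k} \<and> d l = i. f (d l))"
      using assms(1) by (intro sum.group [symmetric]) auto
    also have "\<dots> = (\<Sum>i<s. real (card {l\<in>{1..k}. d l = i}) * f i)"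
      by (intro sum.cong) auto
    finally show ?thesis .
  qed
  hence "(\<lambda>k. (\<Sum>l=1..k. f (d l)) / real k) =
         (\<lambda>k. \<Sum>i<s. real (card {l\<in>{1..k}. d l = i}) / real k * f i)"
    by (simp add: sum_divide_distrib)
  also have "\<dots> \<longlonglongrightarrow> (\<Sum>i<s. p i * f i)"
    using assms(2) unfolding has_frequencies_def by (intro tendsto_intros) auto
  finally show ?thesis .
qed

lemma ln_word_weight_digits:
  assumes "\<And>l. l \<ge> 1 \<Longrightarrow> r (d l) > 0"
  shows "ln (word_weight r (digits d k)) = (\<Sum>l=1..k. ln (r (d l)))"
  unfolding word_weight_digits using assms by (subst ln_prod) (auto simp: less_imp_neq[symmetric] order_less_imp_not_eq2)

text \<open>
  The exponential growth rate of a weight along digits with frequencies \<open>p\<close> is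
  \<open>\<Sum>i<s. p i * ln (r i)\<close>. Both dimension bounds compare two such rates, one for lengths and one
  for masses; the factor \<open>exp (c * k)\<close> keeps part of the gap, which makes the covers of the upper
  bound summable over all ranks.
\<close>

lemma eventually_word_weight_le:
  assumes dig: "\<And>l. l \<ge> 1 \<Longrightarrow> d l < s" and freq: "has_frequencies s d p"
    and r: "\<And>l. l \<ge> 1 \<Longrightarrow> r (d l) > 0" and r': "\<And>l. l \<ge> 1 \<Longrightarrow> r' (d l) > 0"
    and less: "a * (\<Sum>i<s. p i * ln (r i)) + c < b * (\<Sum>i<s. p i * ln (r' i))"
  shows "\<forall>\<^sub>F k in sequentially. word_weight r (digits d k) powr a * exp (c * real k)
           \<le> word_weight r' (digits d k) powr b"
proof -
  let ?f = "\<lambda>i. a * ln (r i) - b * ln (r' i)"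
  have "(\<lambda>k. (\<Sum>l=1..k. ?f (d l)) / real k) \<longlonglongrightarrow> (\<Sum>i<s. p i * ?f i)"
    by (rule has_frequencies_imp_average) fact+
  moreover have "(\<Sum>i<s. p i * ?f i) < - c"
    using less by (simp add: sum_subtractf right_diff_distrib sum_distrib_left mult.left_commute)
  ultimately have "\<forall>\<^sub>F k in sequentially. (\<Sum>l=1..k. ?f (d l)) / real k < - c"
    by (rule order_tendstoD)
  thus ?thesis using eventually_gt_at_top[of 0]
  proof eventually_elim
    case (elim k)
    have pos: "word_weight r (digits d k) > 0" "word_weight r' (digits d k) > 0"
      unfolding word_weight_digits using r r' by (auto intro!: prod_pos)
    have "(\<Sum>l=1..k. ?f (d l)) < - c * real k"
      using elim by (simp add: divide_less_eq)
    hence "a * ln (word_weight r (digits d k)) + c * real k \<le> b * ln (word_weight r' (digits d k))"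
      using r r' by (simp add: ln_word_weight_digits sum_subtractf sum_distrib_left)
    hence "exp (a * ln (word_weight r (digits d k)) + c * real k) \<le> exp (b * ln (word_weight r' (digits d k)))"
      by simp
    thus ?case using pos by (simp add: powr_def exp_add)
  qed
qed

section \<open>Cylinders with constant ratios\<close>

locale ratio_vector =
  fixes s :: nat and q :: "nat \<Rightarrow> real"
  assumes two_le_s: "s \<ge> 2"
    and q_pos: "\<And>i. i < s \<Longrightarrow> q i > 0" and q_sum: "(\<Sum>i<s. q i) = 1"
begin

definition q_max :: real where "q_max = Max (q ` {..<s})"
definition q_min :: real where "q_min = Min (q ` {..<s})"

lemma alphabet_nonempty: "{..<s} \<noteq> {}"
  using two_le_s by (auto simp: lessThan_empty_iff)

lemma q_le_q_max: "i < s \<Longrightarrow> q i \<le> q_max"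
  unfolding q_max_def by (intro Max_ge) auto

lemma q_min_le_q: "i < s \<Longrightarrow> q_min \<le> q i"
  unfolding q_min_def by (intro Min_le) auto

lemma q_less_1: "i < s \<Longrightarrow> q i < 1"
proof -
  assume i: "i < s"
  have "\<exists>j<s. j \<noteq> i" using two_le_s by (metis zero_less_one less_le_trans one_less_numeral_iff semiring_norm(76) zero_neq_one nat_less_le)
  then obtain j where j: "j < s" "j \<noteq> i" by blast
  have "(\<Sum>l\<in>{i, j}. q l) \<le> (\<Sum>l<s. q l)"
    using i j q_pos by (intro sum_mono2) (auto intro: less_imp_le)
  thus "q i < 1" using j q_pos[of j] q_sum by auto
qed

lemma q_max_less_1: "q_max < 1"
  unfolding q_max_def using alphabet_nonempty q_less_1 by (subst Max_less_iff) auto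

lemma q_min_pos: "q_min > 0"
  unfolding q_min_def using alphabet_nonempty q_pos by (subst Min_gr_iff) auto

lemma q_min_less_1: "q_min < 1"
  using q_min_le_q[of 0] q_less_1[of 0] two_le_s by simp

lemma q_max_nonneg: "q_max \<ge> 0"
  using q_le_q_max[of 0] q_pos[of 0] two_le_s by simp

lemma word_weight_pos: "set w \<subseteq> {..<s} \<Longrightarrow> word_weight q w > 0"
  by (induction w) (auto intro!: mult_pos_pos q_pos)

lemma word_weight_le: "set w \<subseteq> {..<s} \<Longrightarrow> word_weight q w \<le> q_max ^ length w"
proof (induction w)
  case (Cons i w)
  thus ?case using q_le_q_max[of i] q_pos[of i] word_weight_pos[of w]
    by (auto intro!: mult_mono intro: less_imp_le)
qed simp

lemma word_weight_ge: "set w \<subseteq> {..<s} \<Longrightarrow> q_min ^ length w \<le> word_weight q w"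
proof (induction w)
  case (Cons i w)
  thus ?case using q_min_le_q[of i] q_pos[of i] q_min_pos
    by (auto intro!: mult_mono intro: less_imp_le)
qed simp

lemma sum_q_Suc_le: "i < j \<Longrightarrow> j \<le> s \<Longrightarrow> (\<Sum>l<i. q l) + q i \<le> (\<Sum>l<j. q l)"
proof -
  assume ij: "i < j" "j \<le> s"
  have "(\<Sum>l<Suc i. q l) \<le> (\<Sum>l<j. q l)"
    using ij q_pos by (intro sum_mono2) (auto intro: less_imp_le)
  thus ?thesis by simp
qed

lemma word_left_bounds:
  assumes "set w \<subseteq> {..<s}"
  shows "0 \<le> word_left q w" "word_left q w + word_weight q w \<le> 1"
proof -
  have "0 \<le> word_left q w \<and> word_left q w + word_weight q w \<le> 1"
    using assms
  proof (induction w)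
    case (Cons i w)
    have i: "i < s" using Cons by auto
    have "word_left q (i # w) + word_weight q (i # w) = (\<Sum>j<i. q j) + q i * (word_left q w + word_weight q w)"
      by (simp add: algebra_simps)
    also have "\<dots> \<le> (\<Sum>j<i. q j) + q i * 1"
      using Cons q_pos[OF i] by (intro add_left_mono mult_left_mono) auto
    also have "\<dots> \<le> 1" using sum_q_Suc_le[of i s] i q_sum by simp
    finally show ?case using Cons i q_pos
      by (auto intro!: add_nonneg_nonneg sum_nonneg mult_nonneg_nonneg intro: less_imp_le[OF q_pos])
  qed auto
  thus "0 \<le> word_left q w" "word_left q w + word_weight q w \<le> 1" by auto
qed

lemma word_cylinder_append_subset:
  assumes "set v \<subseteq> {..<s}" "set w \<subseteq> {..<s}"
  shows "word_cylinder q (v @ w) \<subseteq> word_cylinder q v"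
proof -
  have "word_weight q v * (word_left q w + word_weight q w) \<le> word_weight q v * 1"
    using assms word_weight_pos[of v] word_left_bounds[of w] by (intro mult_left_mono) auto
  moreover have "word_weight q v * word_left q w \<ge> 0"
    using assms word_weight_pos[of v] word_left_bounds[of w] by auto
  ultimately show ?thesis
    by (auto simp: word_cylinder_def word_left_append algebra_simps)
qed

lemma word_cylinder_subset_unit: "set w \<subseteq> {..<s} \<Longrightarrow> word_cylinder q w \<subseteq> {0..1}"
  using word_left_bounds[of w] by (auto simp: word_cylinder_def)

text \<open>
  At the first position where two incomparable words differ, the intervals of the two letters are
  separated, and the common prefix acts on them as an increasing affine map.
\<close>

lemma parallel_word_cylinders:
  assumes v: "set v \<subseteq> {..<s}" and w: "set w \<subseteq> {..<s}" and "v \<parallel> w"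
  shows "word_left q v + word_weight q v \<le> word_left q w \<or>
         word_left q w + word_weight q w \<le> word_left q v"
proof -
  have *: "word_left q (u @ i # v) + word_weight q (u @ i # v) \<le> word_left q (u @ j # w)"
    if "i < j" "j < s" "set u \<subseteq> {..<s}" "set v \<subseteq> {..<s}" "set w \<subseteq> {..<s}" for u i j v w
  proof -
    have "word_left q (i # v) + word_weight q (i # v) = (\<Sum>l<i. q l) + q i * (word_left q v + word_weight q v)"
      by (simp add: algebra_simps)
    also have "\<dots> \<le> (\<Sum>l<i. q l) + q i * 1"
      using that word_left_bounds[of v] q_pos[of i] by (intro add_left_mono mult_left_mono) auto
    also have "\<dots> \<le> (\<Sum>l<j. q l)" using sum_q_Suc_le[of i j] that by simp
    also have "\<dots> \<le> word_left q (j # w)"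
      using that word_left_bounds[of w] q_pos[of j] by simp
    finally have "word_weight q u * (word_left q (i # v) + word_weight q (i # v)) \<le>
                  word_weight q u * word_left q (j # w)"
      using that word_weight_pos[of u] by (intro mult_left_mono) auto
    thus ?thesis by (simp add: word_left_append algebra_simps)
  qed
  from parallel_decomp[OF \<open>v \<parallel> w\<close>] obtain u i v' j w'
    where eq: "v = u @ i # v'" "w = u @ j # w'" and "i \<noteq> j" by blast
  hence "i < j \<or> j < i" by auto
  thus ?thesis using *[of i j u v' w'] *[of j i u w' v'] v w unfolding eq by auto
qed

text \<open>
  Separated closed intervals that meet have an endpoint in common, and it is the left endpoint of
  one of them; hence right endpoints need no separate treatment.
\<close>

lemma two_word_cylinders_imp_endpoint:
  assumes "v \<in> words s k" "w \<in> words s k" "v \<noteq> w" "x \<in> word_cylinder q v" "x \<in> word_cylinder q w"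
  shows "x \<in> range (word_left q)"
proof -
  have "v \<parallel> w"
    using assms(1-3) by (intro parallelI) (simp_all add: words_def, (metis append_eq_conv_conj prefixE take_all_iff order_refl)+)
  hence "x = word_left q w \<or> x = word_left q v"
    using parallel_word_cylinders[of v w] assms by (auto simp: words_def word_cylinder_def)
  thus ?thesis by auto
qed

lemma word_weight_digits_tendsto_0:
  assumes dig: "\<And>l. l \<ge> 1 \<Longrightarrow> d l < s"
  shows "(\<lambda>k. word_weight q (digits d k)) \<longlonglongrightarrow> 0"
proof (rule tendsto_sandwich)
  have sub: "set (digits d k) \<subseteq> {..<s}" for k using digits_in_words[of d s k] dig by (auto simp: words_def)
  show "\<forall>\<^sub>F k in sequentially. 0 \<le> word_weight q (digits d k)"
    using word_weight_pos[OF sub] by (intro always_eventually allI less_imp_le)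
  show "\<forall>\<^sub>F k in sequentially. word_weight q (digits d k) \<le> q_max ^ k"
    using word_weight_le[OF sub] by simp
  show "(\<lambda>k. q_max ^ k) \<longlonglongrightarrow> 0"
    using q_max_nonneg q_max_less_1 by (intro LIMSEQ_realpow_zero)
qed auto

lemma Q_point_eqI:
  assumes dig: "\<And>l. l \<ge> 1 \<Longrightarrow> d l < s" and x: "\<And>k. k \<ge> 1 \<Longrightarrow> x \<in> word_cylinder q (digits d k)"
  shows "Q_point (\<lambda>i k. q i) d = x"
  unfolding Q_point_def cylinder_eq_word_cylinder
proof (rule the_equality)
  show "x \<in> (\<Inter>k\<in>{1..}. word_cylinder q (digits d k))" using x by auto
next
  fix y assume y: "y \<in> (\<Inter>k\<in>{1..}. word_cylinder q (digits d k))"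
  have "\<bar>y - x\<bar> \<le> 0"
  proof (rule tendsto_lowerbound[OF word_weight_digits_tendsto_0[OF dig]])
    show "\<forall>\<^sub>F k in sequentially. \<bar>y - x\<bar> \<le> word_weight q (digits d k)"
      using eventually_ge_at_top[of 1]
    proof eventually_elim
      case (elim k)
      thus ?case using x[of k] y by (auto simp: word_cylinder_def abs_le_iff dest!: bspec[of _ _ k])
    qed
  qed auto
  thus "y = x" by simp
qed

text \<open>
  The left endpoints increase and stay below all right endpoints; their limit lies in every cylinder.
  The second part presents \<open>Q_point\<close> as a limit of functions of finitely many digits, from which its
  measurability is read off.
\<close>

lemma Q_point_in_word_cylinder:
  assumes dig: "\<And>l. l \<ge> 1 \<Longrightarrow> d l < s"
  shows "Q_point (\<lambda>i k. q i) d \<in> word_cylinder q (digits d k)"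
    and "(\<lambda>k. word_left q (digits d k)) \<longlonglongrightarrow> Q_point (\<lambda>i k. q i) d"
proof -
  let ?a = "\<lambda>k. word_left q (digits d k)" and ?b = "\<lambda>k. word_left q (digits d k) + word_weight q (digits d k)"
  have sub: "set (digits d k) \<subseteq> {..<s}" for k using digits_in_words[of d s k] dig by (auto simp: words_def)
  have nest: "?a k \<le> ?a (k + m) \<and> ?b (k + m) \<le> ?b k" for k m
  proof -
    obtain w where w: "digits d (k + m) = digits d k @ w" using digits_append by blast
    have "set w \<subseteq> {..<s}" using sub[of "k + m"] w by auto
    hence "word_cylinder q (digits d (k + m)) \<subseteq> word_cylinder q (digits d k)"
      unfolding w by (intro word_cylinder_append_subset sub)
    thus ?thesis using word_weight_pos[OF sub, of "k + m"] by (auto simp: word_cylinder_def)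
  qed
  have ab: "?a k \<le> ?b m" for k m
    using nest[of k m] nest[of m k] word_weight_pos[OF sub, of "k + m"] by (simp add: add.commute)
  have inc: "incseq ?a" unfolding incseq_def using nest by (metis le_iff_add)
  obtain x where x: "?a \<longlonglongrightarrow> x" "\<And>k. ?a k \<le> x"
    using incseq_convergent[OF inc, of "?b 0"] ab by blast
  have "x \<le> ?b m" for m
    by (rule LIMSEQ_le_const2[OF x(1)]) (use ab in auto)
  hence mem: "x \<in> word_cylinder q (digits d k)" for k
    using x(2) by (auto simp: word_cylinder_def)
  have eq: "Q_point (\<lambda>i k. q i) d = x"
    by (rule Q_point_eqI) (use dig mem in auto)
  show "Q_point (\<lambda>i k. q i) d \<in> word_cylinder q (digits d k)" "?a \<longlonglongrightarrow> Q_point (\<lambda>i k. q i) d"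
    using mem x eq by auto
qed

end

section \<open>Uniqueness of representations and measurability of the frequency set\<close>

text \<open>
  Restricting the tolerance to \<open>inverse (real (Suc j))\<close> leaves only countable quantifiers.
\<close>

lemma sets_Collect_LIMSEQ:
  fixes f :: "nat \<Rightarrow> 'a \<Rightarrow> real"
  assumes [measurable]: "\<And>k. f k \<in> borel_measurable M"
  shows "{x\<in>space M. (\<lambda>k. f k x) \<longlonglongrightarrow> c} \<in> sets M"
proof -
  have "((\<lambda>k. f k x) \<longlonglongrightarrow> c) \<longleftrightarrow> (\<forall>j. \<exists>N. \<forall>k\<ge>N. \<bar>f k x - c\<bar> < inverse (real (Suc j)))" for x
  proof
    assume "(\<lambda>k. f k x) \<longlonglongrightarrow> c"
    thus "\<forall>j. \<exists>N. \<forall>k\<ge>N. \<bar>f k x - c\<bar> < inverse (real (Suc j))"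
      by (auto simp: LIMSEQ_iff simp del: of_nat_Suc)
  next
    assume *: "\<forall>j. \<exists>N. \<forall>k\<ge>N. \<bar>f k x - c\<bar> < inverse (real (Suc j))"
    show "(\<lambda>k. f k x) \<longlonglongrightarrow> c"
    proof (rule LIMSEQ_I)
      fix r :: real assume "r > 0"
      then obtain j where j: "inverse (real (Suc j)) < r" using reals_Archimedean by blast
      obtain N where "\<forall>k\<ge>N. \<bar>f k x - c\<bar> < inverse (real (Suc j))" using * by blast
      hence "\<forall>k\<ge>N. norm (f k x - c) < r" using j by (metis order_less_trans real_norm_def)
      thus "\<exists>N. \<forall>k\<ge>N. norm (f k x - c) < r" ..
    qed
  qed
  thus ?thesis by simp
qed

context ratio_vector
begin

lemma countable_endpoints: "countable (range (word_left q))"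
  by (rule countable_image) simp

lemma Q_representation_unique:
  assumes d: "is_Q_representation s (\<lambda>i k. q i) x d" and e: "is_Q_representation s (\<lambda>i k. q i) x e"
    and x: "x \<notin> range (word_left q)" and "l \<ge> 1"
  shows "d l = e l"
proof -
  have "x \<in> word_cylinder q (digits d l)" "x \<in> word_cylinder q (digits e l)"
    using Q_point_in_word_cylinder(1)[of d l] Q_point_in_word_cylinder(1)[of e l] d e
    by (auto simp: is_Q_representation_def)
  moreover have "digits d l \<in> words s l" "digits e l \<in> words s l"
    using d e by (auto simp: is_Q_representation_def intro!: digits_in_words)
  ultimately have "digits d l = digits e l"
    using two_word_cylinders_imp_endpoint x by blast
  thus ?thesis using \<open>l \<ge> 1\<close> by (simp add: digits_eq_iff)
qed

text \<open>
  Off the countable set of endpoints the digits do not depend on the choice made by \<open>rep\<close>: a digit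
  is read off from the cylinder containing the point. There the set is given by limits of Borel
  functions, and its part inside the endpoints is countable, hence Borel whatever \<open>rep\<close> does.
\<close>

lemma frequency_set_borel:
  assumes rep: "\<And>x. x \<in> {0..1} \<Longrightarrow> is_Q_representation s (\<lambda>i k. q i) x (rep x)"
  shows "frequency_set s rep p \<in> sets borel"
proof -
  define B where "B i l = (\<Union>w\<in>{w\<in>words s l. last w = i}. word_cylinder q w)" for i l
  define f where "f i k x = (\<Sum>l=1..k. indicator (B i l) x) / real k" for i k and x :: real
  define G where "G = (\<Inter>i\<in>{..<s}. {x\<in>space borel. (\<lambda>k. f i k x) \<longlonglongrightarrow> p i})"
  define D where "D = range (word_left q)"
  have B_meas [measurable]: "B i l \<in> sets borel" for i l
    unfolding B_def by (intro sets.finite_UN) (auto simp: word_cylinder_def)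
  have "f i k \<in> borel_measurable borel" for i k
    unfolding f_def by measurable
  hence G: "G \<in> sets borel"
    unfolding G_def using alphabet_nonempty by (intro sets.finite_INT sets_Collect_LIMSEQ) auto
  have sub: "countable S" if "S \<subseteq> D" for S
    using that countable_endpoints unfolding D_def by (rule countable_subset)
  have digit: "rep x l = i \<longleftrightarrow> x \<in> B i l" if "x \<in> {0..1} - D" "l \<ge> 1" "i < s" for x l i
  proof -
    have r: "is_Q_representation s (\<lambda>i k. q i) x (rep x)" using rep that by auto
    have w: "digits (rep x) l \<in> words s l" "x \<in> word_cylinder q (digits (rep x) l)"
      using r Q_point_in_word_cylinder(1)[of "rep x" l]
      by (auto simp: is_Q_representation_def intro!: digits_in_words)
    have last: "last (digits (rep x) l) = rep x l"
      using \<open>l \<ge> 1\<close> by (cases l) (auto simp: digits_Suc)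
    have uniq: "w = digits (rep x) l" if "w \<in> words s l" "x \<in> word_cylinder q w" for w
      using two_word_cylinders_imp_endpoint[OF that(1) w(1) _ that(2) w(2)] \<open>x \<in> {0..1} - D\<close>
      by (auto simp: D_def)
    show ?thesis
    proof
      assume "rep x l = i"
      thus "x \<in> B i l" using w last unfolding B_def by blast
    next
      assume "x \<in> B i l"
      then obtain v where v: "v \<in> words s l" "last v = i" "x \<in> word_cylinder q v"
        unfolding B_def by blast
      thus "rep x l = i" using uniq[OF v(1,3)] last by simp
    qed
  qed
  have "x \<in> frequency_set s rep p \<longleftrightarrow> x \<in> G" if x: "x \<in> {0..1} - D" for x
  proof -
    have "real (card {l\<in>{1..k}. rep x l = i}) / real k = f i k x" if "i < s" for i k
    proof -
      have "{l\<in>{1..k}. rep x l = i} = {l\<in>{1..k}. x \<in> B i l}"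
        using digit[OF x _ that] by auto
      thus ?thesis by (simp add: f_def indicator_def sum.If_cases of_bool_def Int_def)
    qed
    thus ?thesis using x by (auto simp: mem_frequency_set_iff has_frequencies_def G_def)
  qed
  moreover have "frequency_set s rep p \<subseteq> {0..1}" by (auto simp: frequency_set_def)
  ultimately have "frequency_set s rep p = ({0..1} - D) \<inter> G \<union> frequency_set s rep p \<inter> D" by blast
  moreover have "D \<in> sets borel" "frequency_set s rep p \<inter> D \<in> sets borel"
    by (rule sets.countable[OF _ sub], auto)+
  ultimately show ?thesis using G by (metis borel_closed closed_atLeastAtMost sets.Diff sets.Int sets.Un)
qed

lemma mem_word_cylinder_Cons:
  assumes "i < s"
  shows "x \<in> word_cylinder q (i # w) \<longleftrightarrow> (x - (\<Sum>j<i. q j)) / q i \<in> word_cylinder q w"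
  using q_pos[OF assms] by (auto simp: word_cylinder_def field_simps)

text \<open>
  The point with all digits \<open>i\<close> is the fixed point of the affine map of \<open>i\<close>. It lies in no
  first-level interval of another digit, and pulling it back along \<open>i\<close> returns the same point, so
  every digit of every representation is \<open>i\<close>.
\<close>

lemma constant_representation_unique:
  assumes i: "i < s" and rep: "is_Q_representation s (\<lambda>i k. q i) (Q_point (\<lambda>i k. q i) (\<lambda>_. i)) d"
    and "l \<ge> 1"
  shows "d l = i"
proof -
  define a where "a = (\<lambda>i. \<Sum>j<i. q j)"
  define x where "x = a i / (1 - q i)"
  have a_le: "a j + q j \<le> a k" if "j < k" "k \<le> s" for j k
    using sum_q_Suc_le[OF that] by (simp add: a_def)
  have a_nonneg: "a j \<ge> 0" if "j < s" for j
    unfolding a_def using that by (intro sum_nonneg) (auto intro: less_imp_le[OF q_pos])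
  have a_s: "a s = 1" by (simp add: a_def q_sum)
  have qi: "0 < q i" "q i < 1" using i q_pos q_less_1 by auto
  have x_eq: "x = a i + q i * x" using qi by (simp add: x_def field_simps)
  have x01: "0 \<le> x" "x \<le> 1" using qi a_nonneg[OF i] a_le[OF i] a_s by (auto simp: x_def field_simps)
  have scale: "(x - (\<Sum>j<i. q j)) / q i = x" using qi x_eq by (simp add: a_def field_simps)
  have "x \<in> word_cylinder q (replicate k i)" for k
    using x01 i by (induction k) (auto simp: mem_word_cylinder_Cons scale, auto simp: word_cylinder_def)
  moreover have "digits (\<lambda>_. i) k = replicate k i" for k
    by (simp add: digits_def map_replicate_const)
  ultimately have x: "Q_point (\<lambda>i k. q i) (\<lambda>_. i) = x"
    using i by (intro Q_point_eqI) auto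
  have uniq: "w = replicate (length w) i" if "set w \<subseteq> {..<s}" "x \<in> word_cylinder q w" for w
    using that
  proof (induction w)
    case (Cons j w)
    have j: "j < s" and w: "set w \<subseteq> {..<s}" using Cons.prems by auto
    have y: "(x - a j) / q j \<in> word_cylinder q w"
      using Cons.prems(2) mem_word_cylinder_Cons[OF j] by (simp add: a_def)
    hence "(x - a j) / q j \<in> {0..1}" using word_cylinder_subset_unit[OF w] by blast
    hence bounds: "a j \<le> x" "x \<le> a j + q j" using q_pos[OF j] by (auto simp: field_simps)
    have "j = i"
    proof (rule ccontr)
      assume "j \<noteq> i"
      then consider "j < i" | "i < j" by linarith
      thus False
      (* The fixed point touches the left end of its interval only if it is 0, and the right end only
         if it is 1, so a neighbouring interval on that side would have to leave the unit interval. *)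
      proof cases
        case 1
        hence "x \<le> a i" "0 < a i" using bounds a_le[of j i] i a_nonneg[OF j] q_pos[OF j] by auto
        moreover from this have "q i * x > 0" using qi by (simp add: x_def)
        ultimately show False using x_eq by linarith
      next
        case 2
        hence "a i + q i \<le> x" "a i + q i < 1"
          using bounds a_le[of i j] a_le[of j s] j q_pos[OF j] a_s by auto
        from this(2) have "x < 1" using qi by (simp add: x_def divide_less_eq)
        hence "q i * x < q i" using qi by simp
        thus False using x_eq \<open>a i + q i \<le> x\<close> by linarith
      qed
    qed
    moreover have "x \<in> word_cylinder q w" using y scale \<open>j = i\<close> by (simp add: a_def)
    ultimately show ?case using Cons.IH w by simp
  qed simp
  have "x \<in> word_cylinder q (digits d l)"
    using Q_point_in_word_cylinder(1)[of d l] rep by (auto simp: is_Q_representation_def x)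
  moreover have "digits d l \<in> words s l"
    using rep by (auto simp: is_Q_representation_def intro!: digits_in_words)
  ultimately have "digits d l = replicate l i" using uniq[of "digits d l"] by (auto simp: words_def)
  hence "\<forall>m\<in>set (digits d l). m = i" by simp
  thus ?thesis using \<open>l \<ge> 1\<close> by (auto simp: set_digits)
qed

end

section \<open>Hausdorff measure and dimension\<close>

text \<open>
  Covers indexed by an arbitrary countable type (here: words) are enumerated as sequences; unused
  indices receive the empty set, whose gauge is 0. Bounding finite partial sums avoids infinite sums
  in the applications.
\<close>

lemma hausdorff_measure_eq_0I:
  fixes E :: "'a::metric_space set"
  assumes cov: "\<And>\<delta> \<eta>::real. \<delta> > 0 \<Longrightarrow> \<eta> > 0 \<Longrightarrow> \<exists>(I::'i::countable set) V. E \<subseteq> (\<Union>i\<in>I. V i) \<and>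
      (\<forall>i\<in>I. bounded (V i) \<and> diameter (V i) \<le> \<delta>) \<and>
      (\<forall>F. finite F \<longrightarrow> F \<subseteq> I \<longrightarrow> (\<Sum>i\<in>F. hausdorff_gauge \<alpha> (V i)) \<le> ennreal \<eta>)"
  shows "hausdorff_measure \<alpha> E = 0"
proof -
  have *: "hausdorff_premeasure \<alpha> \<delta> E \<le> 0 + ennreal \<eta>" if "\<delta> > 0" "\<eta> > 0" for \<delta> \<eta> :: real
  proof -
    obtain I :: "'i set" and V where
      sub: "E \<subseteq> (\<Union>i\<in>I. V i)" and bd: "\<And>i. i \<in> I \<Longrightarrow> bounded (V i) \<and> diameter (V i) \<le> \<delta>" and
      fin: "\<And>F. finite F \<Longrightarrow> F \<subseteq> I \<Longrightarrow> (\<Sum>i\<in>F. hausdorff_gauge \<alpha> (V i)) \<le> ennreal \<eta>"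
      using cov[OF \<open>\<delta> > 0\<close> \<open>\<eta> > 0\<close>] by metis
    define U where "U = (\<lambda>n. if n \<in> to_nat ` I then V (from_nat n) else {})"
    have "U \<in> delta_covers \<delta> E"
      unfolding delta_covers_def
    proof (intro CollectI conjI allI)
      show "E \<subseteq> (\<Union>n. U n)"
      proof
        fix x assume "x \<in> E"
        then obtain i where "i \<in> I" "x \<in> V i" using sub by blast
        hence "x \<in> U (to_nat i)" by (auto simp: U_def)
        thus "x \<in> (\<Union>n. U n)" by blast
      qed
      show "bounded (U n)" "diameter (U n) \<le> \<delta>" for n
        using bd \<open>\<delta> > 0\<close> by (auto simp: U_def)
    qed
    hence "hausdorff_premeasure \<alpha> \<delta> E \<le> (\<Sum>n. hausdorff_gauge \<alpha> (U n))"
      unfolding hausdorff_premeasure_def by (rule INF_lower)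
    also have "\<dots> \<le> ennreal \<eta>"
    proof (rule suminf_le_const)
      fix N
      let ?F = "{i \<in> I. to_nat i < N}"
      have F: "finite ?F"
        by (rule inj_on_finite[of to_nat _ "{..<N}"]) (auto simp: inj_on_def)
      have "(\<Sum>n<N. hausdorff_gauge \<alpha> (U n)) = (\<Sum>n\<in>to_nat ` ?F. hausdorff_gauge \<alpha> (U n))"
        by (intro sum.mono_neutral_right) (auto simp: U_def hausdorff_gauge_def)
      also have "\<dots> = (\<Sum>i\<in>?F. hausdorff_gauge \<alpha> (V i))"
        by (subst sum.reindex) (auto simp: inj_on_def U_def intro!: sum.cong)
      also have "\<dots> \<le> ennreal \<eta>" using F by (intro fin) auto
      finally show "(\<Sum>n<N. hausdorff_gauge \<alpha> (U n)) \<le> ennreal \<eta>" .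
    qed auto
    finally show ?thesis by simp
  qed
  have "hausdorff_premeasure \<alpha> \<delta> E \<le> 0" if "\<delta> > 0" for \<delta>
  proof (rule ennreal_le_epsilon)
    fix \<eta> :: real assume "\<eta> > 0"
    thus "hausdorff_premeasure \<alpha> \<delta> E \<le> 0 + ennreal \<eta>" by (rule *[OF that])
  qed
  hence "hausdorff_measure \<alpha> E \<le> 0"
    unfolding hausdorff_measure_def by (intro SUP_least) auto
  thus ?thesis by simp
qed

lemma hausdorff_dim_leI:
  assumes "a \<ge> 0" and "\<And>\<alpha>. a < \<alpha> \<Longrightarrow> hausdorff_measure \<alpha> E = 0"
  shows "hausdorff_dim E \<le> ereal a"
proof (rule dense_ge)
  fix z assume "ereal a < z"
  then obtain \<alpha> where "a < \<alpha>" "ereal \<alpha> < z" using ereal_dense2[of "ereal a" z] by auto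
  have "hausdorff_dim E \<le> ereal \<alpha>"
    unfolding hausdorff_dim_def using assms \<open>a < \<alpha>\<close> by (intro INF_lower) auto
  thus "hausdorff_dim E \<le> z" using \<open>ereal \<alpha> < z\<close> by simp
qed

lemma hausdorff_dim_geI:
  assumes "\<And>\<alpha>. 0 \<le> \<alpha> \<Longrightarrow> \<alpha> < a \<Longrightarrow> hausdorff_measure \<alpha> E \<noteq> 0"
  shows "ereal a \<le> hausdorff_dim E"
  unfolding hausdorff_dim_def
proof (rule INF_greatest)
  fix \<alpha> assume "\<alpha> \<in> {\<alpha>. 0 \<le> \<alpha> \<and> hausdorff_measure \<alpha> E = 0}"
  thus "ereal a \<le> ereal \<alpha>" using assms[of \<alpha>] by (cases "\<alpha> < a") auto
qed

section \<open>Upper bound: covering by typical cylinders\<close>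

context ratio_vector
begin

lemma sum_ln_q_neg:
  assumes "\<And>i. i < s \<Longrightarrow> p i \<ge> 0" and "(\<Sum>i<s. p i) = 1"
  shows "(\<Sum>i<s. p i * ln (q i)) < 0"
proof -
  have "\<exists>i<s. p i \<noteq> 0" using assms(2) by (metis lessThan_iff sum.neutral zero_neq_one)
  then obtain i where i: "i < s" "p i > 0" using assms(1) by (metis less_eq_real_def)
  have "(\<Sum>i<s. p i * ln (q i)) < (\<Sum>i<s. 0)"
  proof (rule sum_strict_mono_ex1)
    show "\<forall>j\<in>{..<s}. p j * ln (q j) \<le> 0"
      using assms(1) q_pos q_less_1 by (auto intro!: mult_nonneg_nonpos simp: less_imp_le)
    show "\<exists>j\<in>{..<s}. p j * ln (q j) < 0"
      using i q_pos q_less_1 by (intro bexI[of _ i]) (auto intro!: mult_pos_neg simp: ln_less_zero)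
  qed auto
  thus ?thesis by simp
qed

lemma diameter_word_cylinder:
  "set w \<subseteq> {..<s} \<Longrightarrow> diameter (word_cylinder q w) = word_weight q w"
  using word_weight_pos[of w] by (simp add: word_cylinder_def)

text \<open>
  As \<open>L < 0\<close>, the inequality on \<open>\<alpha>\<close> says \<open>\<alpha> > H / L\<close>. A point of \<open>E\<close> only needs \<^emph>\<open>some\<close>
  representation with frequencies \<open>p\<close>, so the bound holds for every choice at the endpoints.
\<close>

lemma hausdorff_measure_frequency_points_eq_0:
  assumes p: "\<And>i. i < s \<Longrightarrow> p i \<ge> 0" and p_sum: "(\<Sum>i<s. p i) = 1"
    and \<alpha>: "\<alpha> * (\<Sum>i<s. p i * ln (q i)) < (\<Sum>i<s. p i * ln (p i))" "\<alpha> > 0"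
    and E: "\<And>x. x \<in> E \<Longrightarrow> \<exists>d. (\<forall>l\<ge>1. d l < s) \<and> has_frequencies s d p \<and> x = Q_point (\<lambda>i k. q i) d"
  shows "hausdorff_measure \<alpha> E = 0"
proof -
  define H where "H = (\<Sum>i<s. p i * ln (p i))"
  define e where "e = (H - \<alpha> * (\<Sum>i<s. p i * ln (q i))) / 2"
  (* Mixing q into p makes all weights positive. As ln ((1 - t) * p i) = ln (p i) - e, the mixing
     lowers the growth rate of the mass by at most e, which is half of the available gap. *)
  define t where "t = 1 - exp (- e)"
  define p' where "p' i = (1 - t) * p i + t * q i" for i
  define c where "c = e / 2"
  have e: "e > 0" using \<alpha> by (simp add: e_def H_def)
  have t: "0 < t" "t < 1" using e by (auto simp: t_def)
  have c: "c > 0" using e by (simp add: c_def)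
  have p'_pos: "p' i > 0" if "i < s" for i
    unfolding p'_def using t p q_pos that by (intro add_nonneg_pos mult_pos_pos mult_nonneg_nonneg) auto
  have p'_sum: "(\<Sum>i<s. p' i) = 1"
    by (simp add: p'_def sum.distrib p_sum q_sum flip: sum_distrib_left)
  have "H - e = (\<Sum>i<s. p i * ln (p i) + p i * ln (1 - t))"
    by (simp add: sum.distrib sum_subtractf p_sum H_def t_def flip: sum_distrib_right)
  also have "\<dots> \<le> (\<Sum>i<s. p i * ln (p' i))"
  proof (rule sum_mono)
    fix i assume i: "i \<in> {..<s}"
    show "p i * ln (p i) + p i * ln (1 - t) \<le> p i * ln (p' i)"
    proof (cases "p i = 0")
      case False
      hence pi: "p i > 0" using p[of i] i by auto
      have "ln (p i) + ln (1 - t) = ln ((1 - t) * p i)"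
        using pi t by (subst ln_mult) auto
      also have "\<dots> \<le> ln (p' i)"
        using pi t q_pos[of i] i p'_pos[of i] by (subst ln_le_cancel_iff) (auto simp: p'_def)
      finally have "p i * (ln (p i) + ln (1 - t)) \<le> p i * ln (p' i)"
        using pi by (intro mult_left_mono) auto
      thus ?thesis by (simp add: distrib_left)
    qed simp
  qed
  finally have "H - e \<le> (\<Sum>i<s. p i * ln (p' i))" .
  moreover have "\<alpha> * (\<Sum>i<s. p i * ln (q i)) = H - 2 * e" by (simp add: e_def field_simps)
  ultimately have less: "\<alpha> * (\<Sum>i<s. p i * ln (q i)) + c < 1 * (\<Sum>i<s. p i * ln (p' i))"
    using e unfolding c_def by linarith

  define x where "x = exp (- c)"
  have x: "0 < x" "x < 1" using c by (auto simp: x_def)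
  (* A point of E lies in a cylinder of a word in G k for every large k. *)
  define G where "G k = {w \<in> words s k. word_weight q w powr \<alpha> \<le> x ^ k * word_weight p' w}" for k
  have G_fin: "finite (G k)" for k unfolding G_def by simp
  have x_pow: "x ^ k * exp (c * real k) = 1" for k
    by (simp add: x_def flip: exp_of_nat_mult exp_add)
  have p'_weight: "word_weight p' w > 0" if "w \<in> words s k" for w k
  proof -
    have "set w \<subseteq> {..<s} \<Longrightarrow> word_weight p' w > 0" by (induction w) (auto intro!: mult_pos_pos p'_pos)
    thus ?thesis using that by (auto simp: words_def)
  qed
  have in_G: "\<forall>\<^sub>F k in sequentially. y \<in> (\<Union>w\<in>G k. word_cylinder q w)" if "y \<in> E" for y
  proof -
    obtain d where d: "\<And>l. l \<ge> 1 \<Longrightarrow> d l < s" "has_frequencies s d p" "y = Q_point (\<lambda>i k. q i) d"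
      using E \<open>y \<in> E\<close> by blast
    have "\<forall>\<^sub>F k in sequentially. word_weight q (digits d k) powr \<alpha> * exp (c * real k)
           \<le> word_weight p' (digits d k) powr 1"
      by (rule eventually_word_weight_le[OF d(1,2) _ _ less]) (use d q_pos p'_pos in auto)
    thus ?thesis
    proof eventually_elim
      case (elim k)
      have dk: "digits d k \<in> words s k" using d by (intro digits_in_words) auto
      have "x ^ k * (word_weight q (digits d k) powr \<alpha> * exp (c * real k)) \<le> x ^ k * word_weight p' (digits d k)"
        using elim p'_weight[OF dk] x by (intro mult_left_mono) auto
      also have "x ^ k * (word_weight q (digits d k) powr \<alpha> * exp (c * real k)) =
                 word_weight q (digits d k) powr \<alpha> * (x ^ k * exp (c * real k))"
        by (simp only: mult_ac)
      finally have "word_weight q (digits d k) powr \<alpha> \<le> x ^ k * word_weight p' (digits d k)"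
        by (simp only: x_pow mult_1_right)
      hence "digits d k \<in> G k" using dk by (simp add: G_def)
      thus ?case using Q_point_in_word_cylinder(1)[of d k] d by blast
    qed
  qed
  show ?thesis
  proof (rule hausdorff_measure_eq_0I)
    fix \<delta> \<eta> :: real assume "\<delta> > 0" "\<eta> > 0"
    have "(\<lambda>n. q_max ^ n) \<longlonglongrightarrow> 0" "(\<lambda>n. x ^ n / (1 - x)) \<longlonglongrightarrow> 0 / (1 - x)"
      using q_max_nonneg q_max_less_1 x by (auto intro!: LIMSEQ_realpow_zero tendsto_divide)
    hence "\<forall>\<^sub>F n in sequentially. q_max ^ n < \<delta>" "\<forall>\<^sub>F n in sequentially. x ^ n / (1 - x) < \<eta>"
      using \<open>\<delta> > 0\<close> \<open>\<eta> > 0\<close> by (auto dest: order_tendstoD)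
    hence "\<forall>\<^sub>F n in sequentially. q_max ^ n < \<delta> \<and> x ^ n / (1 - x) < \<eta>"
      by (rule eventually_conj)
    then obtain n where n: "q_max ^ n < \<delta>" "x ^ n / (1 - x) < \<eta>"
      by (auto simp: eventually_sequentially)
    define I where "I = (\<Union>k\<in>{n..}. G k)"
    have I: "set w \<subseteq> {..<s}" "n \<le> length w" "w \<in> G (length w)" if "w \<in> I" for w
      using that by (auto simp: I_def G_def words_def)
    show "\<exists>(I :: nat list set) V. E \<subseteq> (\<Union>i\<in>I. V i) \<and> (\<forall>i\<in>I. bounded (V i) \<and> diameter (V i) \<le> \<delta>) \<and>
            (\<forall>F. finite F \<longrightarrow> F \<subseteq> I \<longrightarrow> (\<Sum>i\<in>F. hausdorff_gauge \<alpha> (V i)) \<le> ennreal \<eta>)"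
    proof (intro exI[of _ I] exI[of _ "word_cylinder q"] conjI ballI allI impI)
      show "E \<subseteq> (\<Union>w\<in>I. word_cylinder q w)"
      proof
        fix y assume "y \<in> E"
        then obtain N where "\<And>k. k \<ge> N \<Longrightarrow> y \<in> (\<Union>w\<in>G k. word_cylinder q w)"
          using in_G[OF \<open>y \<in> E\<close>] unfolding eventually_sequentially by blast
        from this[of "max n N"] show "y \<in> (\<Union>w\<in>I. word_cylinder q w)"
          unfolding I_def by (auto intro: exI[of _ "max n N"])
      qed
    next
      fix w assume w: "w \<in> I"
      show "bounded (word_cylinder q w)" by (simp add: word_cylinder_def)
      have "word_weight q w \<le> q_max ^ length w" using I w by (intro word_weight_le)
      also have "\<dots> \<le> q_max ^ n" using I w q_max_nonneg q_max_less_1 by (intro power_decreasing) auto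
      finally show "diameter (word_cylinder q w) \<le> \<delta>"
        using I w n by (simp add: diameter_word_cylinder)
    next
      fix F assume F: "finite F" "F \<subseteq> I"
      define K where "K = Suc (Max (insert 0 (length ` F)))"
      have K: "length w < K" if "w \<in> F" for w
        using F that by (auto simp: K_def less_Suc_eq_le)
      have "(\<Sum>w\<in>F. hausdorff_gauge \<alpha> (word_cylinder q w)) = (\<Sum>w\<in>F. ennreal (word_weight q w powr \<alpha>))"
      proof (rule sum.cong)
        fix w assume "w \<in> F"
        hence "set w \<subseteq> {..<s}" using I F by auto
        thus "hausdorff_gauge \<alpha> (word_cylinder q w) = ennreal (word_weight q w powr \<alpha>)"
          using \<alpha>(2) word_weight_pos[of w]
          by (auto simp: hausdorff_gauge_def diameter_word_cylinder) (auto simp: word_cylinder_def)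
      qed simp
      also have "\<dots> = ennreal (\<Sum>w\<in>F. word_weight q w powr \<alpha>)" by (intro sum_ennreal) auto
      also have "\<dots> \<le> ennreal \<eta>"
      proof (rule ennreal_leI)
        have "(\<Sum>w\<in>F. word_weight q w powr \<alpha>) \<le> (\<Sum>w\<in>(\<Union>k\<in>{n..<K}. G k). word_weight q w powr \<alpha>)"
        proof (rule sum_mono2)
          show "F \<subseteq> (\<Union>k\<in>{n..<K}. G k)"
          proof
            fix w assume "w \<in> F"
            thus "w \<in> (\<Union>k\<in>{n..<K}. G k)" using I F K by (intro UN_I[of "length w"]) auto
          qed
        qed (auto simp: G_fin)
        also have "\<dots> = (\<Sum>k=n..<K. \<Sum>w\<in>G k. word_weight q w powr \<alpha>)"
          by (intro sum.UNION_disjoint) (auto simp: G_fin, auto simp: G_def words_def)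
        also have "\<dots> \<le> (\<Sum>k=n..<K. x ^ k)"
        proof (rule sum_mono)
          fix k
          have "(\<Sum>w\<in>G k. word_weight q w powr \<alpha>) \<le> (\<Sum>w\<in>G k. x ^ k * word_weight p' w)"
            by (intro sum_mono) (auto simp: G_def)
          also have "\<dots> \<le> (\<Sum>w\<in>words s k. x ^ k * word_weight p' w)"
            using x p'_weight by (intro sum_mono2) (auto simp: G_def less_imp_le)
          also have "\<dots> = x ^ k" using sum_word_weight[of p' s k] p'_sum by (simp flip: sum_distrib_left)
          finally show "(\<Sum>w\<in>G k. word_weight q w powr \<alpha>) \<le> x ^ k" .
        qed
        also have "\<dots> \<le> x ^ n / (1 - x)"
        proof (cases "n \<le> K")
          case True
          have "(1 - x) * (\<Sum>k=n..<K. x ^ k) = x ^ n - x ^ K"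
            using True by (induction rule: dec_induct) (simp_all add: distrib_left, simp add: algebra_simps)
          also have "\<dots> \<le> x ^ n" using x by simp
          finally show ?thesis using x by (simp add: le_divide_eq mult.commute)
        qed (use x in auto)
        also have "\<dots> \<le> \<eta>" using n by simp
        finally show "(\<Sum>w\<in>F. word_weight q w powr \<alpha>) \<le> \<eta>" .
      qed
      finally show "(\<Sum>w\<in>F. hausdorff_gauge \<alpha> (word_cylinder q w)) \<le> ennreal \<eta>" .
    qed
  qed
qed

end

section \<open>Cylinders of comparable length\<close>

context ratio_vector
begin

text \<open>
  Compare Lebesgue measures. Half-open intervals make the separated cylinders genuinely disjoint.
\<close>

lemma sum_word_weight_parallel_le:
  assumes "finite W" and par: "\<And>v w. v \<in> W \<Longrightarrow> w \<in> W \<Longrightarrow> v \<noteq> w \<Longrightarrow> v \<parallel> w"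
    and W: "\<And>w. w \<in> W \<Longrightarrow> set w \<subseteq> {..<s}" and sub: "\<And>w. w \<in> W \<Longrightarrow> word_cylinder q w \<subseteq> {a..b}"
    and "a \<le> b"
  shows "(\<Sum>w\<in>W. word_weight q w) \<le> b - a"
proof -
  let ?C = "\<lambda>w. {word_left q w ..< word_left q w + word_weight q w}"
  have "(\<Sum>w\<in>W. word_weight q w) = (\<Sum>w\<in>W. measure lborel (?C w))"
    using W word_weight_pos by (intro sum.cong) (auto simp: less_imp_le)
  also have "\<dots> = measure lborel (\<Union>w\<in>W. ?C w)"
  proof (rule measure_finite_Union [symmetric])
    show "disjoint_family_on ?C W"
      unfolding disjoint_family_on_def
    proof (intro ballI impI)
      fix v w assume "v \<in> W" "w \<in> W" "v \<noteq> w"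
      thus "?C v \<inter> ?C w = {}" using parallel_word_cylinders[OF W W par, of v w] by auto
    qed
  qed (use \<open>finite W\<close> W word_weight_pos in \<open>auto simp: less_imp_le\<close>)
  also have "\<dots> \<le> measure lborel {a..b}"
  proof (rule measure_mono_fmeasurable)
    show "(\<Union>w\<in>W. ?C w) \<subseteq> {a..b}"
      using sub by (force simp: word_cylinder_def)
  qed (use \<open>finite W\<close> \<open>a \<le> b\<close> in \<open>auto intro!: fmeasurableI\<close>)
  finally show ?thesis using \<open>a \<le> b\<close> by simp
qed

text \<open>
  Cylinders of one rank can have very different lengths. Stopping each digit sequence at the first
  rank where the length drops to \<open>r\<close> yields instead cylinders of length comparable to \<open>r\<close>. The
  condition on \<open>butlast w\<close> suffices for ``first'' because lengths decrease along prefixes.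
\<close>

definition stopping_words :: "real \<Rightarrow> nat list set" where
  "stopping_words r = {w. set w \<subseteq> {..<s} \<and> w \<noteq> [] \<and> word_weight q w \<le> r \<and> r < word_weight q (butlast w)}"

lemma word_weight_prefix_le:
  assumes "prefix v w" "set w \<subseteq> {..<s}"
  shows "word_weight q w \<le> word_weight q v"
proof -
  obtain u where "w = v @ u" using assms(1) by (auto simp: prefix_def)
  thus ?thesis using assms(2) word_weight_pos[of v] word_left_bounds[of u]
    mult_left_mono[of "word_weight q u" 1 "word_weight q v"] by auto
qed

lemma parallel_stopping_words:
  assumes "v \<in> stopping_words r" "w \<in> stopping_words r" "v \<noteq> w"
  shows "v \<parallel> w"
proof -
  have "\<not> prefix v w" if v: "v \<in> stopping_words r" and w: "w \<in> stopping_words r" and "v \<noteq> w" for v w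
  proof
    assume "prefix v w"
    have "w \<noteq> []" and sub: "set w \<subseteq> {..<s}" using w by (auto simp: stopping_words_def)
    have eq: "w = butlast w @ [last w]" using \<open>w \<noteq> []\<close> by simp
    hence "prefix v (butlast w)"
      using \<open>prefix v w\<close> \<open>v \<noteq> w\<close> by (metis prefix_snoc)
    hence "word_weight q (butlast w) \<le> word_weight q v"
      using sub by (intro word_weight_prefix_le) (auto dest: in_set_butlastD)
    thus False using v w by (auto simp: stopping_words_def)
  qed
  thus ?thesis using assms by (intro parallelI) auto
qed

lemma stopping_words_weight_ge:
  assumes "w \<in> stopping_words r"
  shows "q_min * r \<le> word_weight q w"
proof -
  have "w \<noteq> []" and sub: "set w \<subseteq> {..<s}" and r: "r < word_weight q (butlast w)"
    using assms by (auto simp: stopping_words_def)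
  have "word_weight q w = word_weight q (butlast w) * q (last w)"
    using \<open>w \<noteq> []\<close> by (subst append_butlast_last_id[symmetric]) (auto simp del: append_butlast_last_id)
  moreover have "q_min \<le> q (last w)" using last_in_set[OF \<open>w \<noteq> []\<close>] sub by (intro q_min_le_q) auto
  moreover have "word_weight q (butlast w) > 0" using sub by (intro word_weight_pos) (auto dest: in_set_butlastD)
  ultimately show ?thesis using r q_min_pos by (subst mult.commute) (auto intro!: mult_mono)
qed

lemma finite_stopping_words:
  assumes "r > 0"
  shows "finite (stopping_words r)"
proof -
  obtain N where N: "q_max ^ N < r"
    using real_arch_pow_inv[OF assms q_max_less_1] by blast
  have "stopping_words r \<subseteq> {w. set w \<subseteq> {..<s} \<and> length w \<le> N}"
  proof
    fix w assume w: "w \<in> stopping_words r"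
    hence "word_weight q (butlast w) \<le> q_max ^ length (butlast w)"
      by (intro word_weight_le) (auto simp: stopping_words_def dest: in_set_butlastD)
    hence "q_max ^ N < q_max ^ (length w - 1)" using w N by (auto simp: stopping_words_def)
    hence "length w - 1 < N" using q_max_nonneg q_max_less_1
      by (meson linorder_not_less power_decreasing less_imp_le)
    thus "w \<in> {w. set w \<subseteq> {..<s} \<and> length w \<le> N}" using w by (auto simp: stopping_words_def)
  qed
  thus ?thesis by (rule finite_subset) (intro finite_lists_length_le, simp)
qed

lemma stopping_words_length:
  assumes "w \<in> stopping_words r" "r < q_min ^ n"
  shows "n \<le> length w"
proof (rule ccontr)
  assume "\<not> n \<le> length w"
  hence "q_min ^ n \<le> q_min ^ length w" using q_min_pos q_min_less_1 by (intro power_decreasing) auto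
  also have "\<dots> \<le> word_weight q w" using assms by (intro word_weight_ge) (auto simp: stopping_words_def)
  finally show False using assms by (auto simp: stopping_words_def)
qed

lemma ex_digits_stopping_word:
  assumes dig: "\<And>l. l \<ge> 1 \<Longrightarrow> d l < s" and r: "0 < r" "r < 1"
  shows "\<exists>k. digits d k \<in> stopping_words r"
proof -
  have "\<forall>\<^sub>F k in sequentially. word_weight q (digits d k) < r"
    by (rule order_tendstoD(2)[OF word_weight_digits_tendsto_0 r(1)]) (rule dig)
  then obtain N where "word_weight q (digits d N) < r"
    unfolding eventually_sequentially by blast
  hence N: "word_weight q (digits d N) \<le> r" by simp
  define k where "k = (LEAST k. word_weight q (digits d k) \<le> r)"
  have k: "word_weight q (digits d k) \<le> r" "\<And>j. j < k \<Longrightarrow> r < word_weight q (digits d j)"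
    unfolding k_def using LeastI[of "\<lambda>k. word_weight q (digits d k) \<le> r", OF N]
    by (auto dest: not_less_Least)
  have "k \<noteq> 0"
  proof
    assume "k = 0"
    thus False using k(1) r(2) by simp
  qed
  then obtain m where m: "k = Suc m" by (cases k) auto
  have "digits d k \<in> stopping_words r"
    using k digits_in_words[of d s k] dig unfolding m by (auto simp: stopping_words_def words_def digits_Suc)
  thus ?thesis by blast
qed

end

section \<open>Law of large numbers for indicators\<close>

text \<open>
  Hoeffding's inequality bounds the probability of a deviation by \<open>\<epsilon>\<close> at time \<open>k\<close> by a geometric
  sequence in \<open>k\<close>; by Borel--Cantelli only finitely many such deviations occur.
\<close>

lemma (in prob_space) AE_tendsto_indicator_frequency:
  fixes B :: "nat \<Rightarrow> 'a \<Rightarrow> bool"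
  assumes ind: "indep_vars (\<lambda>_. borel) (\<lambda>k \<omega>. of_bool (B k \<omega>) :: real) {1..}"
    and prob: "\<And>k. k \<ge> 1 \<Longrightarrow> prob {\<omega>\<in>space M. B k \<omega>} = c"
  shows "AE \<omega> in M. (\<lambda>k. real (card {l\<in>{1..k}. B l \<omega>}) / real k) \<longlonglongrightarrow> c"
proof -
  let ?Y = "\<lambda>k \<omega>. of_bool (B k \<omega>) :: real"
  have Y_meas: "?Y k \<in> borel_measurable M" if "k \<ge> 1" for k
    using ind that unfolding indep_vars_def by auto
  have card_eq: "real (card {l\<in>{1..k}. B l \<omega>}) = (\<Sum>l\<in>{1..k}. ?Y l \<omega>)" for k \<omega>
    by (simp add: sum.If_cases of_bool_def Int_def)
  have expY: "expectation (?Y k) = c" if "k \<ge> 1" for k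
  proof -
    have "{\<omega>\<in>space M. B k \<omega>} = ?Y k -` {1} \<inter> space M" by auto
    also have "\<dots> \<in> events" using Y_meas[OF that] by (rule measurable_sets) auto
    finally have "{\<omega>\<in>space M. B k \<omega>} \<in> events" .
    moreover have "expectation (?Y k) = expectation (indicator {\<omega>\<in>space M. B k \<omega>})"
      by (intro Bochner_Integration.integral_cong) (auto simp: indicator_def)
    ultimately show ?thesis using prob[OF that] by simp
  qed
  have bound: "prob {\<omega>\<in>space M. \<bar>(\<Sum>l\<in>{1..k}. ?Y l \<omega>) - real k * c\<bar> \<ge> \<epsilon> * real k} \<le> 2 * exp (- 2 * \<epsilon>\<^sup>2) ^ k"
    if "k \<ge> 1" "\<epsilon> > 0" for k \<epsilon>
  proof -
    interpret Hoeffding_ineq M "{1..k}" ?Y "\<lambda>_. 0" "\<lambda>_. 1" "real k * c"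
    proof unfold_locales
      show "indep_vars (\<lambda>_. borel) ?Y {1..k}"
        by (rule indep_vars_subset[OF ind]) auto
      have "(\<Sum>l\<in>{1..k}. expectation (?Y l)) = (\<Sum>l\<in>{1..k}. c)"
        by (intro sum.cong expY) auto
      thus "real k * c \<equiv> (\<Sum>l\<in>{1..k}. expectation (?Y l))" by simp
    qed auto
    have "prob {\<omega>\<in>space M. \<bar>(\<Sum>l\<in>{1..k}. ?Y l \<omega>) - real k * c\<bar> \<ge> \<epsilon> * real k}
        \<le> 2 * exp (- 2 * (\<epsilon> * real k)\<^sup>2 / (\<Sum>i\<in>{1..k}. (1 - 0)\<^sup>2))"
      by (rule Hoeffding_ineq_abs_ge) (use that in auto)
    also have "- 2 * (\<epsilon> * real k)\<^sup>2 / (\<Sum>i\<in>{1..k}. (1 - 0)\<^sup>2) = real k * (- 2 * \<epsilon>\<^sup>2)"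
      using \<open>k \<ge> 1\<close> by (simp add: power2_eq_square field_simps)
    also have "exp (real k * (- 2 * \<epsilon>\<^sup>2)) = exp (- 2 * \<epsilon>\<^sup>2) ^ k" by (rule exp_of_nat_mult)
    finally show ?thesis .
  qed
  have ev: "AE \<omega> in M. \<forall>\<^sub>F k in sequentially. \<bar>(\<Sum>l\<in>{1..k}. ?Y l \<omega>) / real k - c\<bar> < \<epsilon>"
    if "\<epsilon> > 0" for \<epsilon>
  proof -
    let ?A = "\<lambda>k. {\<omega>\<in>space M. \<bar>(\<Sum>l\<in>{1..k}. ?Y l \<omega>) - real k * c\<bar> \<ge> \<epsilon> * real k}"
    have [measurable]: "(\<lambda>\<omega>. \<Sum>l\<in>{1..k}. ?Y l \<omega>) \<in> borel_measurable M" for k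
      by (intro borel_measurable_sum Y_meas) simp
    have A: "?A k \<in> events" for k by measurable
    have "AE \<omega> in M. \<forall>\<^sub>F k in sequentially. \<omega> \<in> space M - ?A k"
    proof (rule borel_cantelli_AE1)
      have "exp (- 2 * \<epsilon>\<^sup>2) < 1" using that by simp
      hence "summable (\<lambda>k. 2 * exp (- 2 * \<epsilon>\<^sup>2) ^ k)"
        by (intro summable_mult summable_geometric) simp
      thus "summable (\<lambda>k. prob (?A k))"
        by (rule summable_comparison_test_ev[rotated])
           (use bound[OF _ that] in \<open>auto simp: eventually_sequentially intro!: exI[of _ 1]\<close>)
      show "?A k \<in> events" for k by (rule A)
      show "emeasure M (?A k) < \<infinity>" for k by (simp only: emeasure_eq_measure infinity_ennreal_def ennreal_less_top)
    qed
    thus ?thesis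
    proof eventually_elim
      case (elim \<omega>)
      thus ?case using eventually_gt_at_top[of 0]
      proof eventually_elim
        case (elim k)
        hence "\<bar>(\<Sum>l\<in>{1..k}. ?Y l \<omega>) - real k * c\<bar> < \<epsilon> * real k" by auto
        moreover have "(\<Sum>l\<in>{1..k}. ?Y l \<omega>) / real k - c = ((\<Sum>l\<in>{1..k}. ?Y l \<omega>) - real k * c) / real k"
          using elim by (simp add: field_simps)
        ultimately show ?case using elim by (simp add: abs_divide divide_less_eq)
      qed
    qed
  qed
  have "AE \<omega> in M. \<forall>n. \<forall>\<^sub>F k in sequentially. \<bar>(\<Sum>l\<in>{1..k}. ?Y l \<omega>) / real k - c\<bar> < inverse (real (Suc n))"
    by (subst AE_all_countable) (intro allI ev, simp)
  thus ?thesis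
  proof eventually_elim
    case (elim \<omega>)
    show ?case unfolding card_eq
    proof (rule tendstoI)
      fix e :: real assume "e > 0"
      then obtain n where n: "inverse (real (Suc n)) < e" using reals_Archimedean by blast
      show "\<forall>\<^sub>F k in sequentially. dist ((\<Sum>l\<in>{1..k}. ?Y l \<omega>) / real k) c < e"
        using elim[rule_format, of n] by (rule eventually_mono) (use n in \<open>auto simp: dist_real_def\<close>)
    qed
  qed
qed

section \<open>The random point\<close>

locale random_Q_point = ratio_vector s q + prob_space M
  for s :: nat and q :: "nat \<Rightarrow> real" and M :: "'w measure" +
  fixes p :: "nat \<Rightarrow> real" and X :: "nat \<Rightarrow> 'w \<Rightarrow> nat" and \<xi> :: "'w \<Rightarrow> real"
  assumes p_nonneg: "\<And>i. i < s \<Longrightarrow> p i \<ge> 0" and p_sum: "(\<Sum>i<s. p i) = 1"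
    and indep: "indep_vars (\<lambda>_. count_space {..<s}) X {1..}"
    and X_distr: "\<And>k i. k \<ge> 1 \<Longrightarrow> i < s \<Longrightarrow> prob {\<omega> \<in> space M. X k \<omega> = i} = p i"
    and \<xi>_eq: "\<And>\<omega>. \<omega> \<in> space M \<Longrightarrow> \<xi> \<omega> = Q_point (\<lambda>i k. q i) (\<lambda>k. X k \<omega>)"
begin

definition symbols :: "'w \<Rightarrow> nat \<Rightarrow> nat list" where
  "symbols \<omega> k = digits (\<lambda>l. X l \<omega>) k"

lemma X_measurable: "k \<ge> 1 \<Longrightarrow> X k \<in> measurable M (count_space {..<s})"
  using indep unfolding indep_vars_def by auto

lemma X_less: "k \<ge> 1 \<Longrightarrow> \<omega> \<in> space M \<Longrightarrow> X k \<omega> < s"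
  using measurable_space[OF X_measurable] by auto

lemma X_event: "k \<ge> 1 \<Longrightarrow> {\<omega> \<in> space M. X k \<omega> = i} \<in> events"
proof -
  assume k: "k \<ge> 1"
  have "{\<omega> \<in> space M. X k \<omega> = i} = X k -` ({i} \<inter> {..<s}) \<inter> space M"
    using X_less[OF k] by auto
  thus ?thesis using measurable_sets[OF X_measurable[OF k], of "{i} \<inter> {..<s}"] by simp
qed

lemma symbols_in_words: "\<omega> \<in> space M \<Longrightarrow> symbols \<omega> k \<in> words s k"
  unfolding symbols_def by (rule digits_in_words) (rule X_less)

lemma symbols_eq_event:
  assumes "w \<in> words s k"
  shows "{\<omega> \<in> space M. symbols \<omega> k = w} \<in> events"
    and "prob {\<omega> \<in> space M. symbols \<omega> k = w} = word_weight p w"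
proof -
  define d where "d l = w ! (l - 1)" for l
  have len: "length w = k" and sub: "set w \<subseteq> {..<s}" using assms by (auto simp: words_def)
  have w: "w = digits d k"
    using len by (intro nth_equalityI) (auto simp: digits_def d_def simp del: upt_Suc)
  have d: "d l < s" if "l \<in> {1..k}" for l
    using that sub unfolding w set_digits by (auto simp: image_subset_iff)
  have eq: "{\<omega> \<in> space M. symbols \<omega> k = w} = {\<omega>\<in>space M. \<forall>l\<in>{1..k}. X l \<omega> = d l}"
    unfolding symbols_def w digits_eq_iff ..
  show "{\<omega> \<in> space M. symbols \<omega> k = w} \<in> events"
    unfolding eq by (intro sets.sets_Collect_finite_All' sets.sets_Collect_finite_All X_event) auto
  show "prob {\<omega> \<in> space M. symbols \<omega> k = w} = word_weight p w"
  proof (cases "k = 0")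
    case True
    thus ?thesis using len by (simp add: symbols_def prob_space)
  next
    case False
    have "{\<omega>\<in>space M. \<forall>l\<in>{1..k}. X l \<omega> = d l} = (\<Inter>l\<in>{1..k}. X l -` {d l} \<inter> space M)"
      using False by auto
    also have "prob \<dots> = (\<Prod>l=1..k. prob (X l -` {d l} \<inter> space M))"
      using False d by (intro indep_varsD[OF indep]) auto
    also have "\<dots> = (\<Prod>l=1..k. p (d l))"
    proof (rule prod.cong)
      fix l assume l: "l \<in> {1..k}"
      have "X l -` {d l} \<inter> space M = {\<omega> \<in> space M. X l \<omega> = d l}" by auto
      thus "prob (X l -` {d l} \<inter> space M) = p (d l)" using X_distr d[OF l] l by simp
    qed simp
    finally show ?thesis unfolding eq by (simp add: w word_weight_digits)
  qed
qed

lemma symbols_event: "{\<omega> \<in> space M. P (symbols \<omega> k)} \<in> events"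
proof -
  have "{\<omega> \<in> space M. P (symbols \<omega> k)} = (\<Union>w\<in>{w\<in>words s k. P w}. {\<omega> \<in> space M. symbols \<omega> k = w})"
    using symbols_in_words by auto
  also have "\<dots> \<in> events"
    by (intro sets.finite_UN) (auto intro: symbols_eq_event)
  finally show ?thesis .
qed

lemma \<xi>_in_word_cylinder: "\<omega> \<in> space M \<Longrightarrow> \<xi> \<omega> \<in> word_cylinder q (symbols \<omega> k)"
  unfolding \<xi>_eq symbols_def by (rule Q_point_in_word_cylinder) (rule X_less)

lemma \<xi>_in_unit: "\<omega> \<in> space M \<Longrightarrow> \<xi> \<omega> \<in> {0..1}"
  using \<xi>_in_word_cylinder[of \<omega> 0] by (simp add: symbols_def word_cylinder_def)

lemma \<xi>_measurable [measurable]: "\<xi> \<in> borel_measurable M"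
proof (rule borel_measurable_LIMSEQ_real)
  show "(\<lambda>k. word_left q (symbols \<omega> k)) \<longlonglongrightarrow> \<xi> \<omega>" if "\<omega> \<in> space M" for \<omega>
    unfolding \<xi>_eq[OF that] symbols_def by (rule Q_point_in_word_cylinder) (rule X_less[OF _ that])
  show "(\<lambda>\<omega>. word_left q (symbols \<omega> k)) \<in> borel_measurable M" for k
  proof (rule measurableI)
    fix A :: "real set"
    have "(\<lambda>\<omega>. word_left q (symbols \<omega> k)) -` A \<inter> space M = {\<omega> \<in> space M. word_left q (symbols \<omega> k) \<in> A}"
      by auto
    also have "\<dots> \<in> events" by (rule symbols_event)
    finally show "(\<lambda>\<omega>. word_left q (symbols \<omega> k)) -` A \<inter> space M \<in> events" .
  qed auto
qed

lemma AE_has_frequencies: "AE \<omega> in M. has_frequencies s (\<lambda>k. X k \<omega>) p"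
proof -
  have "AE \<omega> in M. (\<lambda>k. real (card {l\<in>{1..k}. X l \<omega> = i}) / real k) \<longlonglongrightarrow> p i" if "i < s" for i
  proof (rule AE_tendsto_indicator_frequency)
    have "indep_vars (\<lambda>_. borel) (\<lambda>k \<omega>. (\<lambda>j. of_bool (j = i) :: real) (X k \<omega>)) {1..}"
      by (rule indep_vars_compose2[OF indep]) auto
    thus "indep_vars (\<lambda>_. borel) (\<lambda>k \<omega>. of_bool (X k \<omega> = i) :: real) {1..}" .
    show "prob {\<omega>\<in>space M. X k \<omega> = i} = p i" if "k \<ge> 1" for k
      using X_distr that \<open>i < s\<close> by simp
  qed
  hence "AE \<omega> in M. \<forall>i\<in>{..<s}. (\<lambda>k. real (card {l\<in>{1..k}. X l \<omega> = i}) / real k) \<longlonglongrightarrow> p i"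
    by (intro AE_finite_allI) auto
  thus ?thesis by (auto simp: has_frequencies_def)
qed

text \<open>
  Digits of probability 0 almost surely never occur. This is what allows logarithms of \<open>p\<close> along the
  random digits, in spite of \<open>ln 0 = 0\<close>.
\<close>

lemma AE_p_X_pos: "AE \<omega> in M. \<forall>k\<ge>1. p (X k \<omega>) > 0"
proof -
  have "AE \<omega> in M. k \<ge> 1 \<longrightarrow> p (X k \<omega>) > 0" for k
  proof (cases "k \<ge> 1")
    case True
    have "AE \<omega> in M. \<forall>i\<in>{i. i < s \<and> p i = 0}. X k \<omega> \<noteq> i"
    proof (rule AE_finite_allI)
      fix i assume i: "i \<in> {i. i < s \<and> p i = 0}"
      hence "prob {\<omega> \<in> space M. X k \<omega> = i} = 0" using X_distr True by simp
      thus "AE \<omega> in M. X k \<omega> \<noteq> i"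
        using X_event[OF True] by (subst (asm) prob_eq_0) auto
    qed auto
    with AE_space show ?thesis
    proof eventually_elim
      case (elim \<omega>)
      thus ?case using X_less[OF True] p_nonneg[of "X k \<omega>"] by (auto simp: less_le)
    qed
  qed auto
  hence "AE \<omega> in M. \<forall>k. k \<ge> 1 \<longrightarrow> p (X k \<omega>) > 0" by (simp add: AE_all_countable)
  thus ?thesis .
qed

end

section \<open>Lower bound: the mass of small balls\<close>

context random_Q_point
begin

text \<open>
  The event on which, from rank \<open>n\<close> on, the mass of the cylinders around the random point is bounded
  by the power \<open>\<alpha>\<close> of their length.
\<close>

definition tame_event :: "real \<Rightarrow> nat \<Rightarrow> 'w set" where
  "tame_event \<alpha> n =
     {\<omega> \<in> space M. \<forall>k\<ge>n. word_weight p (symbols \<omega> k) \<le> word_weight q (symbols \<omega> k) powr \<alpha>}"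

lemma tame_event_sets [measurable]: "tame_event \<alpha> n \<in> events"
proof -
  have eq: "tame_event \<alpha> n =
      {\<omega> \<in> space M. \<forall>k. k \<ge> n \<longrightarrow> word_weight p (symbols \<omega> k) \<le> word_weight q (symbols \<omega> k) powr \<alpha>}"
    by (simp add: tame_event_def)
  show ?thesis unfolding eq by (intro sets.sets_Collect_countable_All symbols_event)
qed

lemma tame_cball_event: "{\<omega> \<in> tame_event \<alpha> n. \<xi> \<omega> \<in> cball u r} \<in> events"
proof -
  have "{\<omega> \<in> tame_event \<alpha> n. \<xi> \<omega> \<in> cball u r} = tame_event \<alpha> n \<inter> (\<xi> -` cball u r \<inter> space M)"
    by (auto simp: tame_event_def)
  thus ?thesis using measurable_sets[OF \<xi>_measurable, of "cball u r"] by simp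
qed

lemma AE_tame_event:
  assumes "(\<Sum>i<s. p i * ln (p i)) < \<alpha> * (\<Sum>i<s. p i * ln (q i))"
  shows "AE \<omega> in M. \<exists>n. \<omega> \<in> tame_event \<alpha> n"
  using AE_has_frequencies AE_p_X_pos AE_space
proof eventually_elim
  case (elim \<omega>)
  have "\<forall>\<^sub>F k in sequentially. word_weight p (digits (\<lambda>l. X l \<omega>) k) powr 1 * exp (0 * real k)
          \<le> word_weight q (digits (\<lambda>l. X l \<omega>) k) powr \<alpha>"
    by (rule eventually_word_weight_le[OF _ elim(1)]) (use elim X_less q_pos assms in auto)
  moreover have "word_weight p (digits (\<lambda>l. X l \<omega>) k) > 0" for k
    unfolding word_weight_digits using elim by (intro prod_pos) auto
  hence "word_weight p (digits (\<lambda>l. X l \<omega>) k) powr 1 * exp (0 * real k) = word_weight p (symbols \<omega> k)" for k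
    by (simp add: symbols_def less_imp_le)
  ultimately show ?case
    using elim unfolding tame_event_def symbols_def eventually_sequentially by simp
qed

text \<open>
  Stop the digits at length \<open>r\<close>; since \<open>r < q_min ^ n\<close>, this happens at rank \<open>n\<close> or later, so the
  tame bound applies to the stopping cylinder. The stopping cylinders that meet the ball lie in an
  interval of length \<open>4 * r\<close> and have length at least \<open>q_min * r\<close>, which limits their number to
  \<open>4 / q_min\<close>, each of mass at most \<open>r powr \<alpha>\<close>.
\<close>

lemma prob_tame_event_cball_le_of_pos:
  assumes r: "0 < r" "r < q_min ^ n" and "\<alpha> \<ge> 0"
  shows "prob {\<omega> \<in> tame_event \<alpha> n. \<xi> \<omega> \<in> cball u r} \<le> 4 / q_min * r powr \<alpha>"
proof -
  define W where "W = {w \<in> stopping_words r. word_cylinder q w \<inter> cball u r \<noteq> {} \<and>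
                          word_weight p w \<le> word_weight q w powr \<alpha>}"
  have "q_min ^ n \<le> 1" using q_min_pos q_min_less_1 by (intro power_le_one) auto
  hence "r < 1" using r by simp
  have fin: "finite W" using finite_stopping_words[OF r(1)] by (simp add: W_def)
  have W: "set w \<subseteq> {..<s}" "word_weight q w \<le> r" "q_min * r \<le> word_weight q w" if "w \<in> W" for w
    using that stopping_words_weight_ge by (auto simp: W_def stopping_words_def)
  have ev: "{\<omega> \<in> space M. symbols \<omega> (length w) = w} \<in> events"
    and pr: "prob {\<omega> \<in> space M. symbols \<omega> (length w) = w} = word_weight p w" if "w \<in> W" for w
    using symbols_eq_event[of w "length w"] W[OF that] by (auto simp: words_def)
  have "{\<omega> \<in> tame_event \<alpha> n. \<xi> \<omega> \<in> cball u r} \<subseteq> (\<Union>w\<in>W. {\<omega> \<in> space M. symbols \<omega> (length w) = w})"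
  proof
    fix \<omega> assume \<omega>: "\<omega> \<in> {\<omega> \<in> tame_event \<alpha> n. \<xi> \<omega> \<in> cball u r}"
    hence sp: "\<omega> \<in> space M" by (simp add: tame_event_def)
    have "\<exists>k. digits (\<lambda>l. X l \<omega>) k \<in> stopping_words r"
      by (rule ex_digits_stopping_word) (use X_less sp r \<open>r < 1\<close> in auto)
    then obtain k where k: "symbols \<omega> k \<in> stopping_words r" by (auto simp: symbols_def)
    have "length (symbols \<omega> k) = k" by (simp add: symbols_def)
    with stopping_words_length[OF k r(2)] have "k \<ge> n" by simp
    hence "symbols \<omega> k \<in> W"
      using \<omega> k \<xi>_in_word_cylinder[OF sp, of k] by (auto simp: W_def tame_event_def)
    thus "\<omega> \<in> (\<Union>w\<in>W. {\<omega> \<in> space M. symbols \<omega> (length w) = w})"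
      using sp \<open>length (symbols \<omega> k) = k\<close> by (intro UN_I[of "symbols \<omega> k"]) auto
  qed
  hence "prob {\<omega> \<in> tame_event \<alpha> n. \<xi> \<omega> \<in> cball u r} \<le> prob (\<Union>w\<in>W. {\<omega> \<in> space M. symbols \<omega> (length w) = w})"
    using ev fin by (intro finite_measure_mono sets.finite_UN) auto
  also have "\<dots> \<le> (\<Sum>w\<in>W. prob {\<omega> \<in> space M. symbols \<omega> (length w) = w})"
    using ev fin by (intro finite_measure_subadditive_finite) auto
  also have "\<dots> = (\<Sum>w\<in>W. word_weight p w)" using pr by simp
  (* Weighting each word by its length replaces counting words by adding up lengths. *)
  also have "\<dots> \<le> (\<Sum>w\<in>W. r powr \<alpha> / (q_min * r) * word_weight q w)"
  proof (rule sum_mono)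
    fix w assume w: "w \<in> W"
    have "word_weight p w \<le> word_weight q w powr \<alpha>" using w by (simp add: W_def)
    also have "\<dots> \<le> r powr \<alpha>" using W[OF w] word_weight_pos[of w] \<open>\<alpha> \<ge> 0\<close> by (intro powr_mono2) auto
    also have "\<dots> = r powr \<alpha> / (q_min * r) * (q_min * r)" using r q_min_pos by simp
    also have "\<dots> \<le> r powr \<alpha> / (q_min * r) * word_weight q w"
      using r q_min_pos W[OF w] by (intro mult_left_mono) auto
    finally show "word_weight p w \<le> r powr \<alpha> / (q_min * r) * word_weight q w" .
  qed
  also have "\<dots> = r powr \<alpha> / (q_min * r) * (\<Sum>w\<in>W. word_weight q w)"
    by (simp add: sum_distrib_left)
  also have "\<dots> \<le> r powr \<alpha> / (q_min * r) * ((u + 2 * r) - (u - 2 * r))"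
  proof (intro mult_left_mono sum_word_weight_parallel_le)
    show "v \<parallel> w" if "v \<in> W" "w \<in> W" "v \<noteq> w" for v w
      using that parallel_stopping_words by (auto simp: W_def)
    fix w assume w: "w \<in> W"
    then obtain y where "y \<in> word_cylinder q w" "\<bar>y - u\<bar> \<le> r"
      by (auto simp: W_def dist_real_def abs_minus_commute)
    thus "word_cylinder q w \<subseteq> {u - 2 * r..u + 2 * r}"
      using W(2)[OF w] by (auto simp: word_cylinder_def)
  qed (use W fin r q_min_pos in auto)
  also have "\<dots> = 4 / q_min * r powr \<alpha>" using r q_min_pos by (simp add: field_simps)
  finally show ?thesis .
qed

text \<open>
  The case \<open>r = 0\<close>, obtained by letting the radius decrease to 0, is needed for covering sets of
  diameter 0 and for excluding atoms.
\<close>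

lemma prob_tame_event_cball_le:
  assumes r: "0 \<le> r" "r < q_min ^ n" and "\<alpha> > 0"
  shows "prob {\<omega> \<in> tame_event \<alpha> n. \<xi> \<omega> \<in> cball u r} \<le> 4 / q_min * r powr \<alpha>"
proof (cases "r = 0")
  case True
  have "q_min ^ n > 0" using q_min_pos by simp
  have "((\<lambda>r. 4 / q_min * r powr \<alpha>) \<longlongrightarrow> 4 / q_min * 0 powr \<alpha>) (at_right 0)"
    using \<open>\<alpha> > 0\<close> by (intro tendsto_intros tendsto_powr') (auto simp: eventually_at_right_less less_imp_le intro: eventually_mono[OF eventually_at_right_less])
  moreover have "\<forall>\<^sub>F r in at_right 0. prob {\<omega> \<in> tame_event \<alpha> n. \<xi> \<omega> \<in> cball u 0} \<le> 4 / q_min * r powr \<alpha>"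
    using eventually_at_right_less[of 0] eventually_at_right_real[OF \<open>q_min ^ n > 0\<close>]
  proof eventually_elim
    case (elim r)
    have "prob {\<omega> \<in> tame_event \<alpha> n. \<xi> \<omega> \<in> cball u 0} \<le> prob {\<omega> \<in> tame_event \<alpha> n. \<xi> \<omega> \<in> cball u r}"
      using elim by (intro finite_measure_mono tame_cball_event) auto
    also have "\<dots> \<le> 4 / q_min * r powr \<alpha>"
      using elim assms by (intro prob_tame_event_cball_le_of_pos) auto
    finally show ?case .
  qed
  ultimately have "prob {\<omega> \<in> tame_event \<alpha> n. \<xi> \<omega> \<in> cball u 0} \<le> 4 / q_min * 0 powr \<alpha>"
    by (intro tendsto_lowerbound) auto
  thus ?thesis using True by simp
qed (use assms prob_tame_event_cball_le_of_pos in auto)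

text \<open>
  Mass distribution principle: any cover of \<open>E\<close> by small sets carries the whole mass of a tame event
  of positive probability, and each covering set carries at most a constant times its gauge. Here the
  inequality on \<open>\<alpha>\<close> says \<open>\<alpha> < H / L\<close>.
\<close>

lemma hausdorff_measure_full_set_ne_0:
  assumes E: "AE \<omega> in M. \<xi> \<omega> \<in> E" and "0 \<le> \<alpha>"
    and \<alpha>: "(\<Sum>i<s. p i * ln (p i)) < \<alpha> * (\<Sum>i<s. p i * ln (q i))"
  shows "hausdorff_measure \<alpha> E \<noteq> 0"
proof -
  have "\<exists>n. prob (tame_event \<alpha> n) \<noteq> 0"
  proof (rule ccontr)
    assume "\<not> ?thesis"
    hence "AE \<omega> in M. \<omega> \<notin> tame_event \<alpha> n" for n
      by (subst AE_iff_measurable[OF tame_event_sets[of \<alpha> n]])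
         (auto simp: emeasure_eq_measure dest: sets.sets_into_space[OF tame_event_sets, THEN subsetD])
    hence "AE \<omega> in M. \<forall>n. \<omega> \<notin> tame_event \<alpha> n" by (simp add: AE_all_countable)
    with AE_tame_event[OF \<alpha>] have "AE \<omega> in M. False" by eventually_elim auto
    thus False by simp
  qed
  then obtain n where n: "prob (tame_event \<alpha> n) > 0"
    using measure_nonneg[of M] by (metis less_eq_real_def)
  define T where "T = tame_event \<alpha> n"
  define C where "C = 4 / q_min"
  define \<delta> where "\<delta> = q_min ^ n / 2"
  have C: "C \<ge> 1" using q_min_pos q_min_less_1 by (simp add: C_def field_simps)
  have \<delta>: "0 < \<delta>" "\<delta> < q_min ^ n" using q_min_pos by (auto simp: \<delta>_def)
  have "ennreal (prob T / C) \<le> hausdorff_premeasure \<alpha> \<delta> E"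
    unfolding hausdorff_premeasure_def
  proof (rule INF_greatest)
    fix U assume "U \<in> delta_covers \<delta> E"
    hence U: "E \<subseteq> (\<Union>j. U j)" "bounded (U j)" "diameter (U j) \<le> \<delta>" for j
      by (auto simp: delta_covers_def)
    (* The sets U j need not be measurable. Each is enlarged to a ball around one of its points,
       with its diameter as radius. *)
    define B where
      "B j = (if U j = {} then {} else {\<omega> \<in> T. \<xi> \<omega> \<in> cball (SOME u. u \<in> U j) (diameter (U j))})" for j
    have B_sets: "B j \<in> events" for j unfolding B_def T_def using tame_cball_event by simp
    have B_le: "emeasure M (B j) \<le> ennreal C * hausdorff_gauge \<alpha> (U j)" for j
    proof (cases "U j = {}")
      case False
      have "prob (B j) \<le> C * (if \<alpha> = 0 then 1 else diameter (U j) powr \<alpha>)"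
      (* For exponent 0 the gauge of a nonempty set is 1, and the ball estimate is replaced by
         the trivial bound. *)
      proof (cases "\<alpha> = 0")
        case True
        have "prob (B j) \<le> C" by (rule order_trans[OF prob_le_1 C])
        thus ?thesis using True by simp
      next
        case nz: False
        thus ?thesis using False \<open>0 \<le> \<alpha>\<close> \<delta> U(2,3)[of j] diameter_ge_0[of "U j"]
          prob_tame_event_cball_le[of "diameter (U j)" n \<alpha>] by (simp add: B_def C_def T_def)
      qed
      thus ?thesis using False C
        by (auto simp: hausdorff_gauge_def emeasure_eq_measure ennreal_mult' [symmetric] intro: ennreal_leI split: if_splits)
    qed (auto simp: B_def)
    have "emeasure M T \<le> emeasure M (\<Union>j. B j)"
    proof (rule emeasure_mono_AE)
      show "AE \<omega> in M. \<omega> \<in> T \<longrightarrow> \<omega> \<in> (\<Union>j. B j)"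
        using E
      proof eventually_elim
        case (elim \<omega>)
        then obtain j where j: "\<xi> \<omega> \<in> U j" using U(1) by blast
        hence "(SOME u. u \<in> U j) \<in> U j" by (rule someI)
        hence "\<xi> \<omega> \<in> cball (SOME u. u \<in> U j) (diameter (U j))"
          using j U(2) diameter_bounded_bound by auto
        thus ?case using j by (auto simp: B_def)
      qed
    qed (use B_sets in auto)
    also have "\<dots> \<le> (\<Sum>j. emeasure M (B j))"
      using B_sets by (intro emeasure_subadditive_countably) auto
    also have "\<dots> \<le> (\<Sum>j. ennreal C * hausdorff_gauge \<alpha> (U j))"
      by (intro suminf_le B_le) auto
    also have "\<dots> = ennreal C * (\<Sum>j. hausdorff_gauge \<alpha> (U j))" by simp
    finally have "emeasure M T / ennreal C \<le> (\<Sum>j. hausdorff_gauge \<alpha> (U j))"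
      using C by (intro divide_le_posI_ennreal) auto
    thus "ennreal (prob T / C) \<le> (\<Sum>j. hausdorff_gauge \<alpha> (U j))"
      using C by (simp add: emeasure_eq_measure divide_ennreal)
  qed
  also have "\<dots> \<le> hausdorff_measure \<alpha> E"
    unfolding hausdorff_measure_def using \<delta> by (intro SUP_upper) auto
  finally have "ennreal (prob T / C) \<le> hausdorff_measure \<alpha> E" .
  moreover have "prob T / C > 0" using n C by (simp add: T_def)
  ultimately show ?thesis by (metis ennreal_eq_0_iff le_zero_eq not_less)
qed

end

section \<open>The distribution is carried by the frequency set\<close>

context random_Q_point
begin

lemma p_le_1: "i < s \<Longrightarrow> p i \<le> 1"
  using member_le_sum[of i "{..<s}" p] p_nonneg p_sum by auto

lemma p_ln_p_nonpos: "i < s \<Longrightarrow> p i * ln (p i) \<le> 0"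
  using p_nonneg[of i] p_le_1[of i]
  by (cases "p i = 0") (auto intro!: mult_nonneg_nonpos simp: ln_le_zero_iff)

lemma sum_p_ln_p_nonpos: "(\<Sum>i<s. p i * ln (p i)) \<le> 0"
  using p_ln_p_nonpos by (intro sum_nonpos) auto

text \<open>
  If \<open>H < 0\<close>, some positive exponent is below \<open>H / L\<close> (half of it is taken), and the ball estimate
  for that exponent leaves no mass on single points.
\<close>

lemma AE_\<xi>_notin_countable:
  assumes neg: "(\<Sum>i<s. p i * ln (p i)) < 0" and "countable D"
  shows "AE \<omega> in M. \<xi> \<omega> \<notin> D"
proof -
  define H where "H = (\<Sum>i<s. p i * ln (p i))"
  define L where "L = (\<Sum>i<s. p i * ln (q i))"
  define \<alpha> where "\<alpha> = H / (2 * L)"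
  have L: "L < 0" unfolding L_def using p_nonneg p_sum by (rule sum_ln_q_neg)
  have H: "H < 0" using neg by (simp add: H_def)
  have \<alpha>: "\<alpha> > 0" "H < \<alpha> * L" using H L by (auto simp: \<alpha>_def zero_less_divide_iff)
  have "AE \<omega> in M. \<omega> \<in> tame_event \<alpha> n \<longrightarrow> \<xi> \<omega> \<noteq> x" for n x
  proof -
    have S: "{\<omega> \<in> tame_event \<alpha> n. \<xi> \<omega> \<in> cball x 0} \<in> events" by (rule tame_cball_event)
    have "prob {\<omega> \<in> tame_event \<alpha> n. \<xi> \<omega> \<in> cball x 0} \<le> 4 / q_min * 0 powr \<alpha>"
      using q_min_pos \<alpha> by (intro prob_tame_event_cball_le) auto
    also have "4 / q_min * 0 powr \<alpha> = 0" by simp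
    finally have "prob {\<omega> \<in> tame_event \<alpha> n. \<xi> \<omega> \<in> cball x 0} = 0"
      by (intro antisym measure_nonneg)
    thus ?thesis using S by (subst (asm) prob_eq_0) auto
  qed
  hence "AE \<omega> in M. \<forall>x\<in>D. \<forall>n. \<omega> \<in> tame_event \<alpha> n \<longrightarrow> \<xi> \<omega> \<noteq> x"
    unfolding AE_ball_countable[OF \<open>countable D\<close>] AE_all_countable by blast
  moreover have "AE \<omega> in M. \<exists>n. \<omega> \<in> tame_event \<alpha> n"
    by (rule AE_tame_event) (use \<alpha> in \<open>simp add: H_def L_def\<close>)
  ultimately show ?thesis by eventually_elim auto
qed

text \<open>
  The law of large numbers speaks about the digits \<open>X\<close>, the frequency set about the digits chosen by
  \<open>rep\<close>. Almost surely they agree, either because endpoints have probability 0, or, when one digit has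
  probability 1, because the value of \<open>\<xi>\<close> has a unique representation.
\<close>

lemma AE_\<xi>_in_frequency_set:
  assumes rep: "\<And>x. x \<in> {0..1} \<Longrightarrow> is_Q_representation s (\<lambda>i k. q i) x (rep x)"
  shows "AE \<omega> in M. \<xi> \<omega> \<in> frequency_set s rep p"
proof -
  have "AE \<omega> in M. \<forall>l\<ge>1. rep (\<xi> \<omega>) l = X l \<omega>"
  proof (cases "(\<Sum>i<s. p i * ln (p i)) < 0")
    case True
    show ?thesis
      using AE_\<xi>_notin_countable[OF True countable_endpoints] AE_space
    proof eventually_elim
      case (elim \<omega>)
      have "is_Q_representation s (\<lambda>i k. q i) (\<xi> \<omega>) (\<lambda>l. X l \<omega>)"
        using elim X_less by (auto simp: is_Q_representation_def \<xi>_eq)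
      thus ?case using Q_representation_unique[OF rep[OF \<xi>_in_unit[OF elim(2)]] _ elim(1)] by blast
    qed
  next
    case False
    have "(\<Sum>i<s. - (p i * ln (p i))) = 0"
      using False sum_p_ln_p_nonpos by (simp add: sum_negf)
    hence zero: "p j * ln (p j) = 0" if "j < s" for j
      using that p_ln_p_nonpos by (subst (asm) sum_nonneg_eq_0_iff) auto
    have p01: "p j = 0 \<or> p j = 1" if "j < s" for j
      using zero[OF that] p_nonneg[OF that] by (cases "p j = 0") auto
    have "\<exists>i<s. p i \<noteq> 0" using p_sum by (metis lessThan_iff sum.neutral zero_neq_one)
    then obtain i where i: "i < s" "p i = 1" using p01 by blast
    have other: "p j = 0" if "j < s" "j \<noteq> i" for j
    proof -
      have "(\<Sum>l\<in>{i, j}. p l) \<le> (\<Sum>l<s. p l)"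
        using i that p_nonneg by (intro sum_mono2) auto
      thus ?thesis using that i p_sum p_nonneg[of j] by auto
    qed
    show ?thesis
      using AE_p_X_pos AE_space
    proof eventually_elim
      case (elim \<omega>)
      have X: "X l \<omega> = i" if "l \<ge> 1" for l
        using elim other[of "X l \<omega>"] X_less[OF that elim(2)] that by force
      have "digits (\<lambda>l. X l \<omega>) k = digits (\<lambda>_. i) k" for k using X by (simp add: digits_eq_iff)
      hence eq: "\<xi> \<omega> = Q_point (\<lambda>i k. q i) (\<lambda>_. i)"
        using elim by (simp add: \<xi>_eq Q_point_def cylinder_eq_word_cylinder)
      from rep[OF \<xi>_in_unit[OF elim(2)]] show ?case
        using constant_representation_unique[OF i(1)] X unfolding eq by auto
    qed
  qed
  with AE_has_frequencies AE_space show ?thesis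
  proof eventually_elim
    case (elim \<omega>)
    have "\<xi> \<omega> \<in> {0..1}" using elim by (intro \<xi>_in_unit)
    moreover have "has_frequencies s (rep (\<xi> \<omega>)) p"
      using elim has_frequencies_cong[of "rep (\<xi> \<omega>)" "\<lambda>l. X l \<omega>"] by auto
    ultimately show ?case by (simp add: mem_frequency_set_iff)
  qed
qed

end

section \<open>The dimension of the distribution\<close>

theorem theorem4:
  fixes s :: nat and q p :: "nat \<Rightarrow> real"
    and \<Omega> :: "'w measure" and X :: "nat \<Rightarrow> 'w \<Rightarrow> nat" and \<xi> :: "'w \<Rightarrow> real"
    and rep :: "real \<Rightarrow> nat \<Rightarrow> nat"
  assumes s: "s \<ge> 2"
    and q_pos: "\<And>i. i < s \<Longrightarrow> q i > 0" and q_sum: "(\<Sum>i<s. q i) = 1"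
    and p_nonneg: "\<And>i. i < s \<Longrightarrow> p i \<ge> 0" and p_sum: "(\<Sum>i<s. p i) = 1"
    and prob: "prob_space \<Omega>"
    and indep: "prob_space.indep_vars \<Omega> (\<lambda>_. count_space {..<s}) X {1..}"
    and X_distr: "\<And>k i. k \<ge> 1 \<Longrightarrow> i < s \<Longrightarrow> measure \<Omega> {\<omega> \<in> space \<Omega>. X k \<omega> = i} = p i"
    and xi: "\<And>\<omega>. \<omega> \<in> space \<Omega> \<Longrightarrow> \<xi> \<omega> = Q_point (\<lambda>i k. q i) (\<lambda>k. X k \<omega>)"
    and rep: "\<And>x. x \<in> {0..1} \<Longrightarrow> is_Q_representation s (\<lambda>i k. q i) x (rep x)"
  shows "emeasure (distr \<Omega> borel \<xi>) (frequency_set s rep p) = 1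
    \<and> hausdorff_dim (frequency_set s rep p) = distribution_dim (distr \<Omega> borel \<xi>)
    \<and> distribution_dim (distr \<Omega> borel \<xi>)
        = ereal ((\<Sum>i<s. p i * ln (p i)) / (\<Sum>i<s. p i * ln (q i)))"
proof -
  interpret prob_space \<Omega> by (rule prob)
  interpret random_Q_point s q \<Omega> p X \<xi>
    by unfold_locales (use assms in auto)
  define H where "H = (\<Sum>i<s. p i * ln (p i))"
  define L where "L = (\<Sum>i<s. p i * ln (q i))"
  let ?M = "frequency_set s rep p" and ?\<mu> = "distr \<Omega> borel \<xi>"
  have L: "L < 0" unfolding L_def using p_nonneg p_sum by (rule sum_ln_q_neg)
  have H: "H \<le> 0" unfolding H_def by (rule sum_p_ln_p_nonpos)
  have borel: "?M \<in> sets borel" using rep by (rule frequency_set_borel)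
  have full_iff: "emeasure ?\<mu> E = 1 \<longleftrightarrow> (AE \<omega> in \<Omega>. \<xi> \<omega> \<in> E)" if "E \<in> sets borel" for E
  proof -
    have "emeasure ?\<mu> E = ennreal (prob (\<xi> -` E \<inter> space \<Omega>))"
      using that by (simp add: emeasure_distr emeasure_eq_measure)
    moreover have "prob (\<xi> -` E \<inter> space \<Omega>) = 1 \<longleftrightarrow> (AE \<omega> in \<Omega>. \<omega> \<in> \<xi> -` E \<inter> space \<Omega>)"
      using measurable_sets[OF \<xi>_measurable that] by (rule prob_eq_1)
    moreover have "(AE \<omega> in \<Omega>. \<omega> \<in> \<xi> -` E \<inter> space \<Omega>) \<longleftrightarrow> (AE \<omega> in \<Omega>. \<xi> \<omega> \<in> E)"
      by (intro AE_cong) auto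
    ultimately show ?thesis by simp
  qed
  have full: "emeasure ?\<mu> ?M = 1"
    using full_iff[OF borel] AE_\<xi>_in_frequency_set[of rep] rep by simp
  have upper: "hausdorff_dim ?M \<le> ereal (H / L)"
  proof (rule hausdorff_dim_leI)
    show "H / L \<ge> 0" using H L by (simp add: divide_nonpos_neg)
    fix \<alpha> assume "H / L < \<alpha>"
    show "hausdorff_measure \<alpha> ?M = 0"
    proof (rule hausdorff_measure_frequency_points_eq_0)
      show "\<alpha> * (\<Sum>i<s. p i * ln (q i)) < (\<Sum>i<s. p i * ln (p i))"
        using \<open>H / L < \<alpha>\<close> L by (simp add: neg_divide_less_eq flip: H_def L_def)
      show "\<alpha> > 0" using \<open>H / L < \<alpha>\<close> \<open>H / L \<ge> 0\<close> by simp
      fix x assume "x \<in> ?M"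
      thus "\<exists>d. (\<forall>l\<ge>1. d l < s) \<and> has_frequencies s d p \<and> x = Q_point (\<lambda>i k. q i) d"
        using rep[of x] by (intro exI[of _ "rep x"]) (auto simp: mem_frequency_set_iff is_Q_representation_def)
    qed (use p_nonneg p_sum in auto)
  qed
  have "ereal (H / L) \<le> distribution_dim ?\<mu>"
    unfolding distribution_dim_def
  proof (rule INF_greatest)
    fix E assume E: "E \<in> {E. E \<in> sets borel \<and> emeasure ?\<mu> E = 1}"
    show "ereal (H / L) \<le> hausdorff_dim E"
    proof (rule hausdorff_dim_geI)
      fix \<alpha> assume "0 \<le> \<alpha>" "\<alpha> < H / L"
      thus "hausdorff_measure \<alpha> E \<noteq> 0"
        using E full_iff[of E] L
        by (intro hausdorff_measure_full_set_ne_0) (auto simp: neg_less_divide_eq simp flip: H_def L_def)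
    qed
  qed
  moreover have "distribution_dim ?\<mu> \<le> hausdorff_dim ?M"
    unfolding distribution_dim_def using borel full by (intro INF_lower) auto
  ultimately show ?thesis using full upper by (auto simp flip: H_def L_def)
qed

end
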